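(* For every fixed graph $H$ on vertex set $\{1,2,\dots,m\}$ and every $\alpha,\theta>0$, there exist constants $c>0$ and $\epsilon>0$ such that the following holds. Let $p\in(0,1]$ and let $\Gamma$ be a graph with vertex subsets $X_1,\dots,X_m$, and suppose that the bipartite graph $(X_i,X_j)_\Gamma$ is $(p,cp^{d_2(H)+3}\sqrt{|X_i||X_j|})$-jumbled for every $i<j$ with $ij\in E(H)$. Let $G$ be a subgraph of $\Gamma$, with the vertex $i$ of $H$ assigned to the vertex subset $X_i$ of $G$. For each edge $ij$ of $H$, assume that $(X_i,X_j)_G$ satisfies $\mathrm{DISC}(q_{ij},p,\epsilon)$, where $\alpha p\le q_{ij}\le p$. Then $$G(H)\ge(1-\theta)q(H),$$ where $G(H)=\frac{1}{|X_1|\cdots|X_m|}\sum_{x_1\in X_1,\dots,x_m\in X_m}\prod_{ij\in E(H)}G(x_i,x_j)$ and $q(H)=\prod_{ij\in E(H)}q_{ij}$.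
   Context: Graphs are finite and simple; vertex subsets are finite and nonempty. A graph $G$ is identified with the characteristic function $G(x,y)\in\{0,1\}$ of its edge set, and $(X,Y)_G$ denotes the bipartite graph induced between $X$ and $Y$, viewed as the restriction of $G$ to $X\times Y$. A bipartite graph $\Gamma$ between $X$ and $Y$ is $(p,\beta)$-jumbled if $\left|\sum_{x\in X,y\in Y}(\Gamma(x,y)-p)u(x)v(y)\right|\le\beta\sqrt{\sum_{x\in X} u(x)}\sqrt{\sum_{y\in Y} v(y)}$ for all $u:X\to[0,1]$, $v:Y\to[0,1]$. A bipartite graph $G$ between $X$ and $Y$ satisfies $\mathrm{DISC}(q,p,\epsilon)$ if $\left|\frac{1}{|X||Y|}\sum_{x\in X,y\in Y}(G(x,y)-q)u(x)v(y)\right|\le\epsilon p$ for all $u:X\to[0,1]$, $v:Y\to[0,1]$. 2-degeneracy $d_2(H)$: given an ordering $v_1,\dots,v_m$ of the vertices of $H$ and $i\le j$, let $N_{i-1}(j)$ be the number of neighbours $v_h$ of $v_j$ with $h\le i-1$. Then $d_2(H)$ is the minimum $d\ge 0$ for which there is an ordering $v_1,\dots,v_m$ of the vertices of $H$ such that $N_{i-1}(i)+N_{i-1}(j)\le 2d$ for every edge $v_iv_j$ with $i<j$. ($d_2(H)$ may be a half-integer.) *)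

theory Defs
  imports Complex_Main "HOL-Library.FuncSet" "Graph_Theory.Graph_Theory"
begin

text \<open>
  A finite simple graph is a \<^locale>\<open>pair_graph\<close>: a finite, loop-free, symmetric digraph without
  parallel arcs. Each undirected edge \<open>xy\<close> is thus present as both arcs \<open>(x, y)\<close> and \<open>(y, x)\<close>.
\<close>

definition char_fun :: "'a pair_pre_digraph \<Rightarrow> 'a \<Rightarrow> 'a \<Rightarrow> real" where
  "char_fun G x y = (if (x, y) \<in> parcs G then 1 else 0)"

text \<open>
  A bipartite graph between \<open>X\<close> and \<open>Y\<close> is given by a function of which only the restriction to
  \<open>X \<times> Y\<close> matters; \<open>X\<close> and \<open>Y\<close> need not be disjoint. In particular, \<open>jumbled (char_fun G) X Y\<close>
  is a statement about the bipartite graph \<open>(X, Y)\<^sub>G\<close>, and likewise for \<open>DISC\<close>.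
\<close>

definition jumbled :: "('a \<Rightarrow> 'b \<Rightarrow> real) \<Rightarrow> 'a set \<Rightarrow> 'b set \<Rightarrow> real \<Rightarrow> real \<Rightarrow> bool" where
  "jumbled \<Gamma> X Y p \<beta> \<longleftrightarrow>
    (\<forall>u \<in> X \<rightarrow> {0..1::real}. \<forall>v \<in> Y \<rightarrow> {0..1::real}.
      \<bar>\<Sum>x\<in>X. \<Sum>y\<in>Y. (\<Gamma> x y - p) * u x * v y\<bar>
        \<le> \<beta> * sqrt (\<Sum>x\<in>X. u x) * sqrt (\<Sum>y\<in>Y. v y))"

definition DISC :: "('a \<Rightarrow> 'b \<Rightarrow> real) \<Rightarrow> 'a set \<Rightarrow> 'b set \<Rightarrow> real \<Rightarrow> real \<Rightarrow> real \<Rightarrow> bool" where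
  "DISC G X Y q p \<epsilon> \<longleftrightarrow>
    (\<forall>u \<in> X \<rightarrow> {0..1::real}. \<forall>v \<in> Y \<rightarrow> {0..1::real}.
      \<bar>1 / (real (card X) * real (card Y)) * (\<Sum>x\<in>X. \<Sum>y\<in>Y. (G x y - q) * u x * v y)\<bar>
        \<le> \<epsilon> * p)"

text \<open>
  For an ordering \<open>v 1, \<dots>, v m\<close> of the vertices, \<open>nbrs_upto H v k j\<close> is the quantity \<open>N\<^sub>k(j)\<close>, the
  number of neighbours of \<open>v j\<close> among \<open>v 1, \<dots>, v k\<close>.
\<close>

definition nbrs_upto :: "'a pair_pre_digraph \<Rightarrow> (nat \<Rightarrow> 'a) \<Rightarrow> nat \<Rightarrow> nat \<Rightarrow> nat" where
  "nbrs_upto H v k j = card {h \<in> {1..k}. (v h, v j) \<in> parcs H}"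

definition two_degenerate :: "'a pair_pre_digraph \<Rightarrow> real \<Rightarrow> bool" where
  "two_degenerate H d \<longleftrightarrow>
    (\<exists>v. bij_betw v {1..card (pverts H)} (pverts H) \<and>
      (\<forall>i \<in> {1..card (pverts H)}. \<forall>j \<in> {1..card (pverts H)}.
        i < j \<and> (v i, v j) \<in> parcs H \<longrightarrow>
          real (nbrs_upto H v (i - 1) i + nbrs_upto H v (i - 1) j) \<le> 2 * d))"

definition two_degeneracy :: "'a pair_pre_digraph \<Rightarrow> real" where
  "two_degeneracy H = (LEAST d. 0 \<le> d \<and> two_degenerate H d)"

text \<open>The minimum over the reals exists, and it is a half-integer.\<close>

lemma two_degeneracy_minimum:
  assumes "finite (pverts H)"
  shows "0 \<le> two_degeneracy H" "two_degenerate H (two_degeneracy H)"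
    and "\<And>d. 0 \<le> d \<Longrightarrow> two_degenerate H d \<Longrightarrow> two_degeneracy H \<le> d"
    and "\<exists>n::nat. two_degeneracy H = real n / 2"
proof -
  define P where "P n \<longleftrightarrow> two_degenerate H (real n / 2)" for n :: nat
  obtain v where v: "bij_betw v {1..card (pverts H)} (pverts H)"
    using ex_bij_betw_nat_finite_1[OF assms] by blast
  have "nbrs_upto H v k j \<le> k" for k j
    unfolding nbrs_upto_def
    using card_mono[OF finite_atLeastAtMost, of "{h \<in> {1..k}. (v h, v j) \<in> parcs H}" 1 k] by fastforce
  then have le: "nbrs_upto H v (i - 1) i + nbrs_upto H v (i - 1) j \<le> 2 * card (pverts H)"
    if "i \<in> {1..card (pverts H)}" for i j
    using that by (smt (verit, best) add_mono atLeastAtMost_iff diff_le_self le_trans mult_2)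
  have "P (2 * card (pverts H))"
    unfolding P_def two_degenerate_def using v
    by (intro exI[of _ v]) (use le in \<open>fastforce simp flip: of_nat_add of_nat_mult\<close>)
  then have least: "P (Least P)" "\<And>n. P n \<Longrightarrow> Least P \<le> n"
    by (auto intro: LeastI Least_le)
  have min: "real (Least P) / 2 \<le> d" if d: "0 \<le> d" "two_degenerate H d" for d
  proof -
    have "real n \<le> 2 * d \<longleftrightarrow> real n \<le> 2 * (real (nat \<lfloor>2 * d\<rfloor>) / 2)" for n :: nat
      using d(1) le_floor_iff[of "int n" "2 * d"] by (simp add: le_nat_iff) linarith
    with d(2) have "P (nat \<lfloor>2 * d\<rfloor>)"
      unfolding P_def two_degenerate_def by metis
    then have "real (Least P) \<le> real (nat \<lfloor>2 * d\<rfloor>)"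
      using least(2) by simp
    then show ?thesis using d(1) by linarith
  qed
  have eq: "two_degeneracy H = real (Least P) / 2"
    unfolding two_degeneracy_def
    by (rule Least_equality) (use least(1) min in \<open>auto simp: P_def\<close>)
  show "0 \<le> two_degeneracy H"
    by (simp add: eq)
  show "two_degenerate H (two_degeneracy H)"
    using least(1) by (simp only: eq P_def)
  show "two_degeneracy H \<le> d" if "0 \<le> d" "two_degenerate H d" for d
    using min[OF that] by (simp only: eq)
  show "\<exists>n::nat. two_degeneracy H = real n / 2"
    using eq by (rule exI)
qed

text \<open>Each undirected edge of a symmetric loop-free digraph is listed exactly once.\<close>

definition up_edges :: "'i::linorder pair_pre_digraph \<Rightarrow> ('i \<times> 'i) set" where
  "up_edges H = {(i, j). (i, j) \<in> parcs H \<and> i < j}"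

text \<open>
  \<open>hom_density H X G\<close> is \<open>G(H)\<close>, where vertex \<open>i\<close> of \<open>H\<close> is assigned to \<open>X i\<close>.
\<close>

definition hom_density ::
    "'i::linorder pair_pre_digraph \<Rightarrow> ('i \<Rightarrow> 'a set) \<Rightarrow> ('a \<Rightarrow> 'a \<Rightarrow> real) \<Rightarrow> real" where
  "hom_density H X G =
    1 / (\<Prod>i\<in>pverts H. real (card (X i))) *
      (\<Sum>x \<in> Pi\<^sub>E (pverts H) X. \<Prod>(i, j) \<in> up_edges H. G (x i) (x j))"

definition edge_weight_prod :: "'i::linorder pair_pre_digraph \<Rightarrow> ('i \<Rightarrow> 'i \<Rightarrow> real) \<Rightarrow> real" where
  "edge_weight_prod H q = (\<Prod>(i, j) \<in> up_edges H. q i j)"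

end

theory Submission
  imports Defs "HOL-Analysis.Convex"
begin

text \<open>
  The vertices of \<open>H\<close> are embedded one at a time, in an ordering that realises the 2-degeneracy.
  After \<open>x\<close> has been chosen for \<open>i\<close>, the set \<open>X j\<close> of every neighbour \<open>j\<close> of \<open>i\<close> is replaced by its
  intersection with the neighbourhood of \<open>x\<close> in \<open>G\<close>, and shrinks by a factor of about \<open>p\<close>. The
  exponent \<open>d\<^sub>2(H) + 3\<close> is such that, relative to the current sets, every pair is still jumbled with
  \<open>\<beta> = c * p ^ 3 * sqrt (\<bar>X\<bar> * \<bar>Y\<bar>)\<close> whenever it matters.

  The point is that regularity is inherited: if \<open>f = G - q\<close> has small discrepancy on \<open>X \<times> Y\<close>, then it
  has small discrepancy between the neighbourhoods of all but few \<open>z\<close>. By Cauchy-Schwarz it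
  suffices that the codegrees \<open>\<Sum>x\<in>X. f x y * f x y'\<close> are small in mean, also when weighted
  by the codegrees of \<open>\<Gamma>\<close>. A second Cauchy-Schwarz with the weight \<open>\<Gamma> + p\<close> dominating \<open>\<bar>f\<bar>\<close>, in which
  \<open>\<Gamma>\<close> may be replaced by \<open>p\<close>, reduces this to the row sums \<open>\<Sum>y\<in>Y. f x y * s y\<close> with bounded
  \<open>s\<close>, where the discrepancy of \<open>f\<close> applies.
\<close>

subsection \<open>Kernels of small discrepancy\<close>

text \<open>Splitting \<open>u\<close> and \<open>v\<close> into positive and negative parts gives
  four sums with nonnegative weights, whence the factor 4. The test functions in
  \<open>bound\<close> are dominated by \<open>\<bar>u x\<bar>\<close> and
  \<open>\<bar>v y\<bar>\<close> rather than by 1, so that bounds depending on their mass, as in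
  jumbledness, survive the passage to signs.\<close>

lemma signed_kernel_bound:
  fixes K :: "'a \<Rightarrow> 'b \<Rightarrow> real"
  assumes bound: "\<And>u' v'. (\<And>x. x \<in> X \<Longrightarrow> 0 \<le> u' x \<and> u' x \<le> \<bar>u x\<bar>) \<Longrightarrow>
      (\<And>y. y \<in> Y \<Longrightarrow> 0 \<le> v' y \<and> v' y \<le> \<bar>v y\<bar>) \<Longrightarrow>
      \<bar>\<Sum>x\<in>X. \<Sum>y\<in>Y. K x y * u' x * v' y\<bar> \<le> C"
  shows "\<bar>\<Sum>x\<in>X. \<Sum>y\<in>Y. K x y * u x * v y\<bar> \<le> 4 * C"
proof -
  define P where "P u' v' = (\<Sum>x\<in>X. \<Sum>y\<in>Y. K x y * u' x * v' y)" for u' v'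
  let ?u1 = "\<lambda>x. max (u x) 0" and ?u2 = "\<lambda>x. max (- u x) 0"
  let ?v1 = "\<lambda>y. max (v y) 0" and ?v2 = "\<lambda>y. max (- v y) 0"
  have eq: "u x = ?u1 x - ?u2 x" "v y = ?v1 y - ?v2 y" for x y
    by auto
  have "P u v = P (\<lambda>x. ?u1 x - ?u2 x) (\<lambda>y. ?v1 y - ?v2 y)"
    using eq by simp
  also have "\<dots> = P ?u1 ?v1 - P ?u1 ?v2 - P ?u2 ?v1 + P ?u2 ?v2"
    unfolding P_def sum_subtractf[symmetric] sum.distrib[symmetric]
    by (intro sum.cong refl) (simp add: algebra_simps)
  finally have "P u v = P ?u1 ?v1 - P ?u1 ?v2 - P ?u2 ?v1 + P ?u2 ?v2" .
  moreover have "\<bar>P ?u1 ?v1\<bar> \<le> C" "\<bar>P ?u1 ?v2\<bar> \<le> C" "\<bar>P ?u2 ?v1\<bar> \<le> C" "\<bar>P ?u2 ?v2\<bar> \<le> C"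
    unfolding P_def by (intro bound; auto)+
  ultimately show ?thesis
    unfolding P_def[symmetric] by linarith
qed

lemma sum_swap_pairs:
  fixes t :: "'a \<Rightarrow> 'b \<Rightarrow> 'c \<Rightarrow> 'd \<Rightarrow> real"
  shows "(\<Sum>i\<in>I. \<Sum>j\<in>J. \<Sum>k\<in>K. \<Sum>l\<in>L. t i j k l) = (\<Sum>k\<in>K. \<Sum>l\<in>L. \<Sum>i\<in>I. \<Sum>j\<in>J. t i j k l)"
proof -
  have "(\<Sum>i\<in>I. \<Sum>j\<in>J. \<Sum>k\<in>K. \<Sum>l\<in>L. t i j k l) = (\<Sum>k\<in>K. \<Sum>i\<in>I. \<Sum>j\<in>J. \<Sum>l\<in>L. t i j k l)"
    by (subst sum.swap[where A=K and B=I]) (intro sum.cong refl sum.swap)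
  also have "\<dots> = (\<Sum>k\<in>K. \<Sum>l\<in>L. \<Sum>i\<in>I. \<Sum>j\<in>J. t i j k l)"
  proof (intro sum.cong refl)
    fix k
    show "(\<Sum>i\<in>I. \<Sum>j\<in>J. \<Sum>l\<in>L. t i j k l) = (\<Sum>l\<in>L. \<Sum>i\<in>I. \<Sum>j\<in>J. t i j k l)"
      by (subst sum.swap[where A=L and B=I]) (intro sum.cong refl sum.swap)
  qed
  finally show ?thesis .
qed

text \<open>For fixed \<open>y\<close> and \<open>y'\<close> the inner double sum is a bilinear form
  of \<open>K\<close> with one test function in \<open>i\<close> and one in \<open>j\<close>, so
  discrepancy bounds for \<open>K\<close> apply to it term by term.\<close>

lemma sum_kernel_square:
  fixes K :: "'a \<Rightarrow> 'b \<Rightarrow> real"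
  shows "(\<Sum>i\<in>I. \<Sum>j\<in>J. K i j * (\<Sum>y\<in>Y. F i y * H j y)\<^sup>2) =
    (\<Sum>y\<in>Y. \<Sum>y'\<in>Y. \<Sum>i\<in>I. \<Sum>j\<in>J. K i j * (F i y * F i y') * (H j y * H j y'))"
  by (subst sum_swap_pairs[symmetric])
    (simp add: power2_eq_square sum_product sum_distrib_left mult_ac)

lemma weighted_Cauchy_Schwarz:
  fixes w h :: "'a \<Rightarrow> 'b \<Rightarrow> real"
  assumes "\<And>i j. i \<in> I \<Longrightarrow> j \<in> J \<Longrightarrow> 0 \<le> w i j"
  shows "(\<Sum>i\<in>I. \<Sum>j\<in>J. w i j * h i j)\<^sup>2 \<le>
    (\<Sum>i\<in>I. \<Sum>j\<in>J. w i j) * (\<Sum>i\<in>I. \<Sum>j\<in>J. w i j * (h i j)\<^sup>2)"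
proof -
  have "(\<Sum>(i,j)\<in>I\<times>J. sqrt (w i j) * (sqrt (w i j) * h i j))\<^sup>2 \<le>
    (\<Sum>(i,j)\<in>I\<times>J. (sqrt (w i j))\<^sup>2) * (\<Sum>(i,j)\<in>I\<times>J. (sqrt (w i j) * h i j)\<^sup>2)"
    unfolding split_def by (rule Cauchy_Schwarz_ineq_sum)
  moreover have "(\<Sum>(i,j)\<in>I\<times>J. sqrt (w i j) * (sqrt (w i j) * h i j)) = (\<Sum>(i,j)\<in>I\<times>J. w i j * h i j)"
    "(\<Sum>(i,j)\<in>I\<times>J. (sqrt (w i j))\<^sup>2) = (\<Sum>(i,j)\<in>I\<times>J. w i j)"
    "(\<Sum>(i,j)\<in>I\<times>J. (sqrt (w i j) * h i j)\<^sup>2) = (\<Sum>(i,j)\<in>I\<times>J. w i j * (h i j)\<^sup>2)"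
    using assms by (auto intro!: sum.cong simp: power_mult_distrib mult.assoc[symmetric])
  ultimately show ?thesis
    by (simp add: sum.cartesian_product)
qed

text \<open>A quasirandom kernel of density \<open>r\<close> with additive error
  \<open>\<tau>\<close> against signed test functions. The condition
  \<open>\<tau> \<le> r\<^sup>2\<close> keeps the error below the main term in the first two moments
  of the degrees.\<close>

locale kernel =
  fixes k :: "'a \<Rightarrow> 'b \<Rightarrow> real" and A :: "'a set" and B :: "'b set" and r \<tau> :: real
  assumes fin: "finite A" "finite B"
    and range: "\<And>x y. x \<in> A \<Longrightarrow> y \<in> B \<Longrightarrow> 0 \<le> k x y \<and> k x y \<le> 1"
    and r: "0 < r" "r \<le> 1"
    and \<tau>: "0 \<le> \<tau>" "\<tau> \<le> r\<^sup>2"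
    and disc: "\<And>u v. (\<And>x. x \<in> A \<Longrightarrow> \<bar>u x\<bar> \<le> 1) \<Longrightarrow> (\<And>y. y \<in> B \<Longrightarrow> \<bar>v y\<bar> \<le> 1) \<Longrightarrow>
      \<bar>\<Sum>x\<in>A. \<Sum>y\<in>B. (k x y - r) * u x * v y\<bar> \<le> \<tau> * card A * card B"
begin

lemma sum_le: "(\<Sum>x\<in>A. \<Sum>y\<in>B. k x y) \<le> 2 * r * card A * card B"
proof -
  have "\<bar>\<Sum>x\<in>A. \<Sum>y\<in>B. (k x y - r) * 1 * 1\<bar> \<le> \<tau> * card A * card B"
    by (rule disc) auto
  then have "(\<Sum>x\<in>A. \<Sum>y\<in>B. k x y) \<le> (r + \<tau>) * card A * card B"
    by (simp add: sum_subtractf algebra_simps)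
  moreover have "r + \<tau> \<le> 2 * r"
    using r \<tau> power_decreasing[of 1 2 r] by simp
  then have "(r + \<tau>) * (real (card A) * card B) \<le> 2 * r * (real (card A) * card B)"
    by (intro mult_right_mono) auto
  ultimately show ?thesis by (simp add: mult.assoc)
qed

text \<open>One factor of the square is used as test function: for each \<open>y'\<close>,
  discrepancy is applied with \<open>k x y'\<close> in \<open>x\<close> and 1 in \<open>y\<close>.
  The error contributes 1 to the constant 3 and the main term contributes 2 through
  \<open>sum_le\<close>.\<close>

lemma sum_square_le: "(\<Sum>x\<in>A. (\<Sum>y\<in>B. k x y)\<^sup>2) \<le> 3 * r\<^sup>2 * card A * (real (card B))\<^sup>2"
proof -
  have 1: "(\<Sum>x\<in>A. \<Sum>y\<in>B. k x y * k x y') \<le> r\<^sup>2 * card A * card B + r * card B * (\<Sum>x\<in>A. k x y')"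
    if "y' \<in> B" for y'
  proof -
    have "\<bar>\<Sum>x\<in>A. \<Sum>y\<in>B. (k x y - r) * k x y' * 1\<bar> \<le> \<tau> * card A * card B"
      using range that by (intro disc) (auto simp: abs_le_iff order_trans[of _ 0])
    moreover have "\<tau> * (real (card A) * card B) \<le> r\<^sup>2 * (real (card A) * card B)"
      using \<tau> by (intro mult_right_mono) auto
    ultimately show ?thesis
      by (simp add: sum_subtractf algebra_simps sum_distrib_left)
  qed
  have "(\<Sum>x\<in>A. (\<Sum>y\<in>B. k x y)\<^sup>2) = (\<Sum>y'\<in>B. \<Sum>x\<in>A. \<Sum>y\<in>B. k x y * k x y')"
    by (subst sum.swap) (simp add: power2_eq_square sum_product mult_ac)
  also have "\<dots> \<le> (\<Sum>y'\<in>B. r\<^sup>2 * card A * card B + r * card B * (\<Sum>x\<in>A. k x y'))"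
    by (intro sum_mono 1)
  also have "\<dots> = r\<^sup>2 * card A * (real (card B))\<^sup>2 + r * card B * (\<Sum>x\<in>A. \<Sum>y'\<in>B. k x y')"
    by (subst sum.swap[where A=A and B=B]) (simp add: sum.distrib sum_distrib_left power2_eq_square mult_ac)
  also have "\<dots> \<le> r\<^sup>2 * card A * (real (card B))\<^sup>2 + r * card B * (2 * r * card A * card B)"
    using r by (intro add_left_mono mult_left_mono sum_le) auto
  also have "\<dots> = 3 * r\<^sup>2 * card A * (real (card B))\<^sup>2"
    by (simp add: power2_eq_square algebra_simps)
  finally show ?thesis .
qed

text \<open>Here the test function is the centred column \<open>k x y' - r\<close>, so no main term
  is left and the bound is of order \<tau>.\<close>

lemma variance_le: "(\<Sum>x\<in>A. ((\<Sum>y\<in>B. k x y) - r * card B)\<^sup>2) \<le> \<tau> * card A * (real (card B))\<^sup>2"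
proof -
  have 1: "(\<Sum>x\<in>A. \<Sum>y\<in>B. (k x y - r) * (k x y' - r)) \<le> \<tau> * card A * card B"
    if "y' \<in> B" for y'
  proof -
    have "\<bar>\<Sum>x\<in>A. \<Sum>y\<in>B. (k x y - r) * (k x y' - r) * 1\<bar> \<le> \<tau> * card A * card B"
    proof (intro disc)
      show "\<bar>k x y' - r\<bar> \<le> 1" if "x \<in> A" for x
        using range[OF that \<open>y' \<in> B\<close>] r by linarith
    qed simp
    then show ?thesis by simp
  qed
  have "(\<Sum>x\<in>A. ((\<Sum>y\<in>B. k x y) - r * card B)\<^sup>2) = (\<Sum>x\<in>A. (\<Sum>y\<in>B. k x y - r)\<^sup>2)"
    by (simp add: sum_subtractf mult.commute)
  also have "\<dots> = (\<Sum>y'\<in>B. \<Sum>x\<in>A. \<Sum>y\<in>B. (k x y - r) * (k x y' - r))"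
    by (subst sum.swap) (simp add: power2_eq_square sum_product mult_ac)
  also have "\<dots> \<le> (\<Sum>y'\<in>B. \<tau> * card A * card B)"
    by (intro sum_mono 1)
  also have "\<dots> = \<tau> * card A * (real (card B))\<^sup>2"
    by (simp add: power2_eq_square mult_ac)
  finally show ?thesis .
qed

end

subsection \<open>Local discrepancy\<close>

lemma abs_prod_le1: "\<bar>s\<bar> \<le> 1 \<Longrightarrow> \<bar>t\<bar> \<le> 1 \<Longrightarrow> \<bar>s * t\<bar> \<le> (1::real)"
  by (simp add: abs_mult mult_le_one)

text \<open>\<open>W\<close> is the graph between \<open>Z\<close> and \<open>Y\<close> with \<open>\<rho> = p\<close> if the neighbourhoods of \<open>z\<close> are taken in \<open>X\<close>
  and \<open>Y\<close>, and constantly 1 with \<open>\<rho> = 1\<close> if only \<open>X\<close> is restricted.\<close>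

locale regular_triple =
  S: kernel S X Y p "\<gamma> * p ^ 3" +
  T: kernel T Z X p "\<gamma> * p ^ 3" +
  W: kernel W Z Y \<rho> "\<gamma> * p ^ 3"
  for S :: "'a \<Rightarrow> 'b \<Rightarrow> real" and T :: "'c \<Rightarrow> 'a \<Rightarrow> real" and W :: "'c \<Rightarrow> 'b \<Rightarrow> real"
    and X Y Z p \<rho> \<gamma> +
  fixes f :: "'a \<Rightarrow> 'b \<Rightarrow> real" and e :: real
  assumes nonempty: "X \<noteq> {}" "Y \<noteq> {}"
    and \<gamma>: "0 \<le> \<gamma>" "\<gamma> \<le> 1" and p_le: "p \<le> \<rho>" and e: "0 \<le> e"
    and T_fine: "\<And>u v. (\<And>z. z \<in> Z \<Longrightarrow> \<bar>u z\<bar> \<le> 1) \<Longrightarrow> (\<And>x. x \<in> X \<Longrightarrow> \<bar>v x\<bar> \<le> 1) \<Longrightarrow>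
      \<bar>\<Sum>z\<in>Z. \<Sum>x\<in>X. (T z x - p) * u z * v x\<bar> \<le>
        \<gamma> * p ^ 3 * sqrt (real (card Z) * card X) * (sqrt (\<Sum>z\<in>Z. \<bar>u z\<bar>) * sqrt (\<Sum>x\<in>X. \<bar>v x\<bar>))"
    and f_le: "\<And>x y. x \<in> X \<Longrightarrow> y \<in> Y \<Longrightarrow> \<bar>f x y\<bar> \<le> 1"
      "\<And>x y. x \<in> X \<Longrightarrow> y \<in> Y \<Longrightarrow> \<bar>f x y\<bar> \<le> S x y + p"
    and f_disc: "\<And>u v. (\<And>x. x \<in> X \<Longrightarrow> \<bar>u x\<bar> \<le> 1) \<Longrightarrow> (\<And>y. y \<in> Y \<Longrightarrow> \<bar>v y\<bar> \<le> 1) \<Longrightarrow>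
      \<bar>\<Sum>x\<in>X. \<Sum>y\<in>Y. f x y * u x * v y\<bar> \<le> e * p * card X * card Y"
begin

abbreviation "a \<equiv> real (card X)"
abbreviation "b \<equiv> real (card Y)"
abbreviation "n \<equiv> real (card Z)"

definition codeg :: "'b \<Rightarrow> 'b \<Rightarrow> real" where
  "codeg y y' = (\<Sum>x\<in>X. f x y * f x y')"

lemma b_pos: "b > 0"
  using nonempty S.fin by (simp add: card_gt_0_iff)

lemma p_pos: "p > 0" and p_le1: "p \<le> 1"
  using S.r by auto

lemma W_abs: "z \<in> Z \<Longrightarrow> y \<in> Y \<Longrightarrow> \<bar>W z y\<bar> \<le> 1"
  using W.range by (simp add: abs_le_iff order_trans[of _ 0])

lemma majorant_sum_le: "(\<Sum>x\<in>X. \<Sum>y\<in>Y. S x y + p) \<le> 3 * p * a * b"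
  using S.sum_le by (simp add: sum.distrib algebra_simps)

lemma abs_f_sum_le: "(\<Sum>x\<in>X. \<Sum>y\<in>Y. \<bar>f x y\<bar>) \<le> 3 * p * a * b"
  by (rule order_trans[OF sum_mono[OF sum_mono[OF f_le(2)]] majorant_sum_le])

lemma majorant_square_le: "(\<Sum>x\<in>X. (\<Sum>y\<in>Y. S x y + p)\<^sup>2) \<le> 8 * p\<^sup>2 * a * b\<^sup>2"
proof -
  have "(\<Sum>x\<in>X. (\<Sum>y\<in>Y. S x y + p)\<^sup>2) =
      (\<Sum>x\<in>X. (\<Sum>y\<in>Y. S x y)\<^sup>2) + 2 * p * b * (\<Sum>x\<in>X. \<Sum>y\<in>Y. S x y) + p\<^sup>2 * a * b\<^sup>2"
    by (simp add: sum.distrib power2_sum power_mult_distrib sum_distrib_left sum_distrib_right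
        mult_ac)
  also have "\<dots> \<le> 3 * p\<^sup>2 * a * b\<^sup>2 + 2 * p * b * (2 * p * a * b) + p\<^sup>2 * a * b\<^sup>2"
    using p_pos by (intro add_mono mult_left_mono S.sum_le S.sum_square_le) auto
  also have "\<dots> = 8 * p\<^sup>2 * a * b\<^sup>2"
    by (simp add: power2_eq_square algebra_simps)
  finally show ?thesis .
qed

text \<open>The rows with \<open>\<bar>h x\<bar> \<le> 3 * p * b\<close> are bounded by testing \<open>f_disc\<close> against \<open>h\<close> itself,
  the other ones have a large degree in \<open>S\<close> and are rare.\<close>

lemma row_square_le:
  assumes s: "\<And>y. y \<in> Y \<Longrightarrow> \<bar>s y\<bar> \<le> 1"
  shows "(\<Sum>x\<in>X. (\<Sum>y\<in>Y. f x y * s y)\<^sup>2) \<le> (3 * e + 9 * \<gamma>) * p\<^sup>2 * a * b\<^sup>2"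
proof -
  define h where "h x = (\<Sum>y\<in>Y. f x y * s y)" for x
  define D where "D x = (\<Sum>y\<in>Y. S x y)" for x
  \<comment> \<open>Truncated and scaled to \<open>[-1, 1]\<close>, so that it is an admissible test
    function for \<open>f_disc\<close>.\<close>
  define t where "t x = (if \<bar>h x\<bar> \<le> 3 * p * b then h x / (3 * p * b) else 0)" for x
  have pb: "p * b > 0" using b_pos p_pos by simp
  have t1: "\<bar>t x\<bar> \<le> 1" for x
    using p_pos b_pos by (auto simp: t_def abs_divide abs_mult)
  have h_le: "\<bar>h x\<bar> \<le> D x + p * b" if "x \<in> X" for x
  proof -
    have "\<bar>h x\<bar> \<le> (\<Sum>y\<in>Y. \<bar>f x y * s y\<bar>)"
      unfolding h_def by (rule sum_abs)
    also have "\<dots> \<le> (\<Sum>y\<in>Y. S x y + p)"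
    proof (rule sum_mono)
      fix y assume "y \<in> Y"
      then show "\<bar>f x y * s y\<bar> \<le> S x y + p"
        using f_le(2)[OF that, of y] s[of y] mult_mono[of "\<bar>f x y\<bar>" "S x y + p" "\<bar>s y\<bar>" 1]
        by (simp add: abs_mult)
    qed
    finally show ?thesis by (simp add: D_def sum.distrib mult.commute)
  qed
  have pointwise: "(h x)\<^sup>2 \<le> 3 * p * b * (h x * t x) + 9 * (D x - p * b)\<^sup>2" if "x \<in> X" for x
  proof (cases "\<bar>h x\<bar> \<le> 3 * p * b")
    case True
    then have "3 * p * b * (h x * t x) = (h x)\<^sup>2"
      using p_pos b_pos by (simp add: t_def power2_eq_square)
    then show ?thesis by simp
  next
    case False
    \<comment> \<open>Here \<open>D x > 2 * p * b\<close>, and then \<open>D x + p * b\<close> is at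
      most three times the deviation \<open>D x - p * b\<close>, which \<open>variance_le\<close>
      controls.\<close>
    then have "\<bar>h x\<bar> \<le> 3 * (D x - p * b)" "0 \<le> 3 * (D x - p * b)"
      using h_le[OF that] pb by auto
    then have "\<bar>h x\<bar>\<^sup>2 \<le> (3 * (D x - p * b))\<^sup>2"
      by (intro power_mono) auto
    also have "\<dots> = 9 * (D x - p * b)\<^sup>2"
      by (subst power_mult_distrib) simp
    finally show ?thesis using False by (simp add: t_def)
  qed
  have "(\<Sum>x\<in>X. (h x)\<^sup>2) \<le> (\<Sum>x\<in>X. 3 * p * b * (h x * t x) + 9 * (D x - p * b)\<^sup>2)"
    by (intro sum_mono pointwise)
  also have "\<dots> = 3 * p * b * (\<Sum>x\<in>X. \<Sum>y\<in>Y. f x y * t x * s y) + 9 * (\<Sum>x\<in>X. (D x - p * b)\<^sup>2)"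
    by (simp add: h_def sum.distrib sum_distrib_left sum_distrib_right mult_ac)
  also have "\<dots> \<le> 3 * p * b * (e * p * a * b) + 9 * (\<gamma> * p ^ 3 * a * b\<^sup>2)"
  proof (intro add_mono mult_left_mono)
    show "(\<Sum>x\<in>X. \<Sum>y\<in>Y. f x y * t x * s y) \<le> e * p * a * b"
      using f_disc[of t s] t1 s by auto
    show "(\<Sum>x\<in>X. (D x - p * b)\<^sup>2) \<le> \<gamma> * p ^ 3 * a * b\<^sup>2"
      unfolding D_def using S.variance_le by simp
  qed (use pb in auto)
  also have "\<dots> \<le> 3 * p * b * (e * p * a * b) + 9 * (\<gamma> * p ^ 2 * a * b\<^sup>2)"
    using p_pos p_le1 \<gamma> by (intro add_mono mult_left_mono mult_right_mono power_decreasing) auto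
  also have "\<dots> = (3 * e + 9 * \<gamma>) * p\<^sup>2 * a * b\<^sup>2"
    by (simp add: power2_eq_square algebra_simps)
  finally show ?thesis unfolding h_def .
qed

text \<open>With the signs of the codegrees inserted, the sum becomes one of
  \<open>f x y' * h y' x\<close>, where \<open>h y' x\<close> is a signed row sum. Cauchy-Schwarz
  with the weight \<open>S + p\<close> leaves the squares of \<open>h\<close> under that weight. The
  weight is split as \<open>(S - p) + 2 * p\<close>: the first part falls to the discrepancy of
  \<open>S\<close>, the second to \<open>row_square_le\<close>.\<close>

lemma codeg_sum_le: "(\<Sum>y\<in>Y. \<Sum>y'\<in>Y. \<bar>codeg y y'\<bar>)\<^sup>2 \<le> (57 * \<gamma> + 18 * e) * (p\<^sup>2 * a * b\<^sup>2)\<^sup>2"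
proof -
  define s where "s y y' = sgn (codeg y y')" for y y'
  define h where "h y' x = (\<Sum>y\<in>Y. f x y * s y y')" for y' x
  have s1: "\<bar>s y y'\<bar> \<le> 1" for y y'
    by (simp add: s_def abs_sgn_eq)
  have "(\<Sum>y\<in>Y. \<Sum>y'\<in>Y. \<bar>codeg y y'\<bar>) = (\<Sum>y\<in>Y. \<Sum>y'\<in>Y. \<Sum>x\<in>X. f x y' * (f x y * s y y'))"
    by (intro sum.cong refl)
      (simp add: s_def abs_sgn codeg_def[symmetric] sum_distrib_right[symmetric] mult_ac,
        simp add: codeg_def sum_distrib_left sum_distrib_right mult_ac)
  also have "\<dots> = (\<Sum>x\<in>X. \<Sum>y'\<in>Y. f x y' * h y' x)"
  proof -
    have "(\<Sum>y\<in>Y. \<Sum>y'\<in>Y. \<Sum>x\<in>X. f x y' * (f x y * s y y')) =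
        (\<Sum>y'\<in>Y. \<Sum>y\<in>Y. \<Sum>x\<in>X. f x y' * (f x y * s y y'))"
      by (rule sum.swap)
    also have "\<dots> = (\<Sum>y'\<in>Y. \<Sum>x\<in>X. \<Sum>y\<in>Y. f x y' * (f x y * s y y'))"
      by (intro sum.cong refl sum.swap)
    also have "\<dots> = (\<Sum>x\<in>X. \<Sum>y'\<in>Y. \<Sum>y\<in>Y. f x y' * (f x y * s y y'))"
      by (rule sum.swap)
    finally show ?thesis by (simp add: h_def sum_distrib_left)
  qed
  finally have eq: "(\<Sum>y\<in>Y. \<Sum>y'\<in>Y. \<bar>codeg y y'\<bar>) = (\<Sum>x\<in>X. \<Sum>y'\<in>Y. f x y' * h y' x)" .
  have le: "(\<Sum>y\<in>Y. \<Sum>y'\<in>Y. \<bar>codeg y y'\<bar>) \<le> (\<Sum>x\<in>X. \<Sum>y'\<in>Y. (S x y' + p) * \<bar>h y' x\<bar>)"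
    unfolding eq
  proof (intro sum_mono)
    fix x y' assume "x \<in> X" "y' \<in> Y"
    have "f x y' * h y' x \<le> \<bar>f x y'\<bar> * \<bar>h y' x\<bar>"
      by (metis abs_ge_self abs_mult)
    also have "\<dots> \<le> (S x y' + p) * \<bar>h y' x\<bar>"
      using f_le(2)[OF \<open>x \<in> X\<close> \<open>y' \<in> Y\<close>] by (intro mult_right_mono) auto
    finally show "f x y' * h y' x \<le> (S x y' + p) * \<bar>h y' x\<bar>" .
  qed
  have main: "(\<Sum>x\<in>X. \<Sum>y'\<in>Y. (S x y' + p) * \<bar>h y' x\<bar>\<^sup>2) \<le> (19 * \<gamma> + 6 * e) * (p ^ 3 * a * b ^ 3)"
  proof -
    have 1: "(\<Sum>x\<in>X. \<Sum>y'\<in>Y. (S x y' - p) * (h y' x)\<^sup>2) \<le> \<gamma> * p ^ 3 * a * b ^ 3"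
    proof -
      have "(\<Sum>x\<in>X. \<Sum>y'\<in>Y. (S x y' - p) * (h y' x)\<^sup>2) =
        (\<Sum>y1\<in>Y. \<Sum>y2\<in>Y. \<Sum>x\<in>X. \<Sum>y'\<in>Y. (S x y' - p) * (f x y1 * f x y2) * (s y1 y' * s y2 y'))"
        unfolding h_def by (rule sum_kernel_square)
      \<comment> \<open>The test functions are \<open>f x y1 * f x y2\<close> in \<open>x\<close>
        and \<open>s y1 y' * s y2 y'\<close> in \<open>y'\<close>.\<close>
      also have "\<dots> \<le> (\<Sum>y1\<in>Y. \<Sum>y2\<in>Y. \<gamma> * p ^ 3 * a * b)"
      proof (intro sum_mono order_trans[OF abs_ge_self S.disc])
      qed (auto intro!: abs_prod_le1 f_le s1)
      also have "\<dots> = \<gamma> * p ^ 3 * a * b ^ 3"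
        by (simp add: power3_eq_cube mult_ac)
      finally show ?thesis .
    qed
    have 2: "(\<Sum>x\<in>X. \<Sum>y'\<in>Y. (h y' x)\<^sup>2) \<le> (3 * e + 9 * \<gamma>) * p\<^sup>2 * a * b ^ 3"
    proof -
      have "(\<Sum>x\<in>X. \<Sum>y'\<in>Y. (h y' x)\<^sup>2) = (\<Sum>y'\<in>Y. \<Sum>x\<in>X. (\<Sum>y\<in>Y. f x y * s y y')\<^sup>2)"
        unfolding h_def by (rule sum.swap)
      also have "\<dots> \<le> (\<Sum>y'\<in>Y. (3 * e + 9 * \<gamma>) * p\<^sup>2 * a * b\<^sup>2)"
        by (intro sum_mono row_square_le s1)
      also have "\<dots> = (3 * e + 9 * \<gamma>) * p\<^sup>2 * a * b ^ 3"
        by (simp add: power3_eq_cube power2_eq_square mult_ac)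
      finally show ?thesis .
    qed
    have "(\<Sum>x\<in>X. \<Sum>y'\<in>Y. (S x y' + p) * \<bar>h y' x\<bar>\<^sup>2) =
        (\<Sum>x\<in>X. \<Sum>y'\<in>Y. (S x y' - p) * (h y' x)\<^sup>2) + 2 * p * (\<Sum>x\<in>X. \<Sum>y'\<in>Y. (h y' x)\<^sup>2)"
      by (simp add: sum_distrib_left sum.distrib[symmetric] algebra_simps)
    also have "\<dots> \<le> \<gamma> * p ^ 3 * a * b ^ 3 + 2 * p * ((3 * e + 9 * \<gamma>) * p\<^sup>2 * a * b ^ 3)"
      using 1 2 p_pos by (intro add_mono mult_left_mono) auto
    also have "\<dots> = (19 * \<gamma> + 6 * e) * (p ^ 3 * a * b ^ 3)"
      by (simp add: power3_eq_cube power2_eq_square algebra_simps)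
    finally show ?thesis .
  qed
  have "(\<Sum>y\<in>Y. \<Sum>y'\<in>Y. \<bar>codeg y y'\<bar>)\<^sup>2 \<le> (\<Sum>x\<in>X. \<Sum>y'\<in>Y. (S x y' + p) * \<bar>h y' x\<bar>)\<^sup>2"
    by (intro power_mono le sum_nonneg) auto
  also have "\<dots> \<le> (\<Sum>x\<in>X. \<Sum>y'\<in>Y. S x y' + p) * (\<Sum>x\<in>X. \<Sum>y'\<in>Y. (S x y' + p) * \<bar>h y' x\<bar>\<^sup>2)"
    using S.range p_pos by (intro weighted_Cauchy_Schwarz add_nonneg_nonneg) auto
  also have "\<dots> \<le> (3 * p * a * b) * ((19 * \<gamma> + 6 * e) * (p ^ 3 * a * b ^ 3))"
    using S.range p_pos
    by (intro mult_mono majorant_sum_le main sum_nonneg mult_nonneg_nonneg add_nonneg_nonneg) auto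
  also have "\<dots> = (57 * \<gamma> + 18 * e) * (p\<^sup>2 * a * b\<^sup>2)\<^sup>2"
    by (simp add: power3_eq_cube power2_eq_square algebra_simps)
  finally show ?thesis .
qed

text \<open>The two factors of \<open>W\<close> are replaced by \<rho> one after the other. In each
  error term one \<open>f\<close> is kept outside; for fixed remaining variables the inner sum is a
  bilinear form of \<open>W - \<rho>\<close> whose test function on \<open>Y\<close> is the sign
  times the other \<open>f\<close>. The outer weight \<bar>f\<bar> has total at most
  \<open>3 * p * a * b\<close>, which supplies the fourth power of \<open>p\<close>.\<close>

lemma codeg_W_sum_le:
  "(\<Sum>y\<in>Y. \<Sum>y'\<in>Y. \<bar>codeg y y'\<bar> * (\<Sum>z\<in>Z. W z y * W z y')) \<le>
    \<rho>\<^sup>2 * n * (\<Sum>y\<in>Y. \<Sum>y'\<in>Y. \<bar>codeg y y'\<bar>) + 6 * \<gamma> * p ^ 4 * a * b\<^sup>2 * n"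
proof -
  define s where "s y y' = sgn (codeg y y')" for y y'
  have s1: "\<bar>s y y'\<bar> \<le> 1" for y y'
    by (simp add: s_def abs_sgn_eq)
  have sg: "\<bar>codeg y y'\<bar> = (\<Sum>x\<in>X. s y y' * (f x y * f x y'))" for y y'
    unfolding sum_distrib_left[symmetric] s_def codeg_def by (simp add: abs_sgn mult.commute)
  have row: "(\<Sum>y\<in>Y. \<Sum>z\<in>Z. (W z y - \<rho>) * u z * v y) \<le> \<gamma> * p ^ 3 * n * b"
    if "\<And>z. z \<in> Z \<Longrightarrow> \<bar>u z\<bar> \<le> 1" "\<And>y. y \<in> Y \<Longrightarrow> \<bar>v y\<bar> \<le> 1" for u v
    by (subst sum.swap) (rule order_trans[OF abs_ge_self W.disc[OF that]])
  have scaled: "f x y * t \<le> \<bar>f x y\<bar> * C" if "\<bar>t\<bar> \<le> C" for x y t C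
  proof -
    have "f x y * t \<le> \<bar>f x y\<bar> * \<bar>t\<bar>" by (metis abs_ge_self abs_mult)
    then show ?thesis using that mult_left_mono[OF that, of "\<bar>f x y\<bar>"] by simp
  qed
  have E1: "(\<Sum>y\<in>Y. \<Sum>y'\<in>Y. \<bar>codeg y y'\<bar> * (\<Sum>z\<in>Z. (W z y - \<rho>) * W z y')) \<le>
      3 * \<gamma> * p ^ 4 * a * b\<^sup>2 * n"
  proof -
    have "(\<Sum>y\<in>Y. \<Sum>y'\<in>Y. \<bar>codeg y y'\<bar> * (\<Sum>z\<in>Z. (W z y - \<rho>) * W z y')) =
        (\<Sum>y\<in>Y. \<Sum>y'\<in>Y. \<Sum>x\<in>X. \<Sum>z\<in>Z. f x y' * ((W z y - \<rho>) * W z y' * (s y y' * f x y)))"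
      unfolding sg by (simp add: sum_distrib_left sum_distrib_right mult_ac)
    also have "\<dots> = (\<Sum>y'\<in>Y. \<Sum>y\<in>Y. \<Sum>x\<in>X. \<Sum>z\<in>Z. f x y' * ((W z y - \<rho>) * W z y' * (s y y' * f x y)))"
      by (rule sum.swap)
    also have "\<dots> = (\<Sum>y'\<in>Y. \<Sum>x\<in>X. \<Sum>y\<in>Y. \<Sum>z\<in>Z. f x y' * ((W z y - \<rho>) * W z y' * (s y y' * f x y)))"
      by (intro sum.cong refl sum.swap)
    also have "\<dots> = (\<Sum>y'\<in>Y. \<Sum>x\<in>X. f x y' * (\<Sum>z\<in>Z. \<Sum>y\<in>Y. (W z y - \<rho>) * W z y' * (s y y' * f x y)))"
      by (subst sum.swap[where A=Z and B=Y]) (simp add: sum_distrib_left)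
    also have "\<dots> \<le> (\<Sum>y'\<in>Y. \<Sum>x\<in>X. \<bar>f x y'\<bar> * (\<gamma> * p ^ 3 * n * b))"
      by (intro sum_mono scaled W.disc abs_prod_le1 s1 f_le W_abs)
    also have "\<dots> = (\<gamma> * p ^ 3 * n * b) * (\<Sum>x\<in>X. \<Sum>y'\<in>Y. \<bar>f x y'\<bar>)"
      by (subst sum.swap) (simp add: sum_distrib_left mult_ac)
    also have "\<dots> \<le> (\<gamma> * p ^ 3 * n * b) * (3 * p * a * b)"
      using \<gamma> p_pos by (intro mult_left_mono abs_f_sum_le) auto
    also have "\<dots> = 3 * \<gamma> * p ^ 4 * a * b\<^sup>2 * n"
      by (simp add: power2_eq_square power3_eq_cube power4_eq_xxxx)
    finally show ?thesis .
  qed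
  have E2: "(\<Sum>y\<in>Y. \<Sum>y'\<in>Y. \<bar>codeg y y'\<bar> * (\<Sum>z\<in>Z. W z y' - \<rho>)) \<le> 3 * \<gamma> * p ^ 4 * a * b\<^sup>2 * n"
  proof -
    have "(\<Sum>y\<in>Y. \<Sum>y'\<in>Y. \<bar>codeg y y'\<bar> * (\<Sum>z\<in>Z. W z y' - \<rho>)) =
        (\<Sum>y\<in>Y. \<Sum>y'\<in>Y. \<Sum>x\<in>X. \<Sum>z\<in>Z. f x y * ((W z y' - \<rho>) * 1 * (s y y' * f x y')))"
      unfolding sg by (simp add: sum_distrib_left sum_distrib_right mult_ac)
    also have "\<dots> = (\<Sum>y\<in>Y. \<Sum>x\<in>X. \<Sum>y'\<in>Y. \<Sum>z\<in>Z. f x y * ((W z y' - \<rho>) * 1 * (s y y' * f x y')))"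
      by (intro sum.cong refl sum.swap)
    also have "\<dots> = (\<Sum>y\<in>Y. \<Sum>x\<in>X. f x y * (\<Sum>z\<in>Z. \<Sum>y'\<in>Y. (W z y' - \<rho>) * 1 * (s y y' * f x y')))"
      by (subst sum.swap[where A=Z and B=Y]) (simp add: sum_distrib_left)
    also have "\<dots> \<le> (\<Sum>y\<in>Y. \<Sum>x\<in>X. \<bar>f x y\<bar> * (\<gamma> * p ^ 3 * n * b))"
      by (intro sum_mono scaled W.disc abs_prod_le1 s1 f_le) auto
    also have "\<dots> = (\<gamma> * p ^ 3 * n * b) * (\<Sum>x\<in>X. \<Sum>y\<in>Y. \<bar>f x y\<bar>)"
      by (subst sum.swap) (simp add: sum_distrib_left mult_ac)
    also have "\<dots> \<le> (\<gamma> * p ^ 3 * n * b) * (3 * p * a * b)"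
      using \<gamma> p_pos by (intro mult_left_mono abs_f_sum_le) auto
    also have "\<dots> = 3 * \<gamma> * p ^ 4 * a * b\<^sup>2 * n"
      by (simp add: power2_eq_square power3_eq_cube power4_eq_xxxx)
    finally show ?thesis .
  qed
  have split: "(\<Sum>z\<in>Z. W z y * W z y') =
      \<rho>\<^sup>2 * n + (\<Sum>z\<in>Z. (W z y - \<rho>) * W z y') + \<rho> * (\<Sum>z\<in>Z. W z y' - \<rho>)" for y y'
    by (simp add: sum_subtractf left_diff_distrib right_diff_distrib sum_distrib_left power2_eq_square)
  have "(\<Sum>y\<in>Y. \<Sum>y'\<in>Y. \<bar>codeg y y'\<bar> * (\<Sum>z\<in>Z. W z y * W z y')) =
      \<rho>\<^sup>2 * n * (\<Sum>y\<in>Y. \<Sum>y'\<in>Y. \<bar>codeg y y'\<bar>) +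
      (\<Sum>y\<in>Y. \<Sum>y'\<in>Y. \<bar>codeg y y'\<bar> * (\<Sum>z\<in>Z. (W z y - \<rho>) * W z y')) +
      \<rho> * (\<Sum>y\<in>Y. \<Sum>y'\<in>Y. \<bar>codeg y y'\<bar> * (\<Sum>z\<in>Z. W z y' - \<rho>))"
    unfolding split sum_distrib_left[of "\<rho>\<^sup>2 * n"] sum_distrib_left[of \<rho> _ Y] sum.distrib[symmetric]
    by (intro sum.cong refl) (simp only: distrib_left mult_ac)
  also have "\<dots> \<le> \<rho>\<^sup>2 * n * (\<Sum>y\<in>Y. \<Sum>y'\<in>Y. \<bar>codeg y y'\<bar>) +
      3 * \<gamma> * p ^ 4 * a * b\<^sup>2 * n + 1 * (3 * \<gamma> * p ^ 4 * a * b\<^sup>2 * n)"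
  proof (intro add_mono order_refl E1)
    have "\<rho> * (\<Sum>y\<in>Y. \<Sum>y'\<in>Y. \<bar>codeg y y'\<bar> * (\<Sum>z\<in>Z. W z y' - \<rho>)) \<le> \<rho> * (3 * \<gamma> * p ^ 4 * a * b\<^sup>2 * n)"
      using W.r by (intro mult_left_mono E2) auto
    also have "\<dots> \<le> 1 * (3 * \<gamma> * p ^ 4 * a * b\<^sup>2 * n)"
      using W.r \<gamma> p_pos by (intro mult_right_mono) auto
    finally show "\<rho> * (\<Sum>y\<in>Y. \<Sum>y'\<in>Y. \<bar>codeg y y'\<bar> * (\<Sum>z\<in>Z. W z y' - \<rho>)) \<le> \<dots>" .
  qed
  finally show ?thesis by (simp add: mult_ac)
qed

text \<open>Cauchy-Schwarz removes \<open>u z\<close> at the price of the weight \<open>T\<close>, which is then replaced by its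
  density \<open>p\<close>. What remains depends on \<open>v z\<close> only through the codegrees of \<open>f\<close>, which are small in
  mean, weighted by the codegrees of \<open>W\<close>.\<close>

lemma local_discrepancy_sum_le:
  assumes u: "\<And>z x. z \<in> Z \<Longrightarrow> x \<in> X \<Longrightarrow> 0 \<le> u z x \<and> u z x \<le> T z x"
    and v: "\<And>z y. z \<in> Z \<Longrightarrow> y \<in> Y \<Longrightarrow> 0 \<le> v z y \<and> v z y \<le> W z y"
  shows "(\<Sum>z\<in>Z. \<bar>\<Sum>x\<in>X. \<Sum>y\<in>Y. f x y * u z x * v z y\<bar>)\<^sup>2 \<le>
    (22 * \<gamma> + 2 * sqrt (57 * \<gamma> + 18 * e)) * (p\<^sup>2 * \<rho> * a * b * n)\<^sup>2"
proof -
  \<comment> \<open>Only \<open>u z x \<le> T z x\<close> is used about \<open>u\<close>; all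
    cancellation comes from the sum over \<open>y\<close>.\<close>
  define h where "h z x = (\<Sum>y\<in>Y. f x y * v z y)" for z x
  define \<delta> where "\<delta> = sqrt (57 * \<gamma> + 18 * e)"
  have \<delta>0: "0 \<le> \<delta>" using \<gamma> e by (simp add: \<delta>_def)
  have v1: "\<bar>v z y\<bar> \<le> 1" if "z \<in> Z" "y \<in> Y" for z y
    using v[OF that] W.range[OF that] by linarith
  have le: "\<bar>\<Sum>x\<in>X. \<Sum>y\<in>Y. f x y * u z x * v z y\<bar> \<le> (\<Sum>x\<in>X. T z x * \<bar>h z x\<bar>)" if "z \<in> Z" for z
  proof -
    have "(\<Sum>x\<in>X. \<Sum>y\<in>Y. f x y * u z x * v z y) = (\<Sum>x\<in>X. u z x * h z x)"
      by (simp add: h_def sum_distrib_left mult_ac)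
    also have "\<bar>\<dots>\<bar> \<le> (\<Sum>x\<in>X. \<bar>u z x * h z x\<bar>)"
      by (rule sum_abs)
    also have "\<dots> \<le> (\<Sum>x\<in>X. T z x * \<bar>h z x\<bar>)"
      using u[OF that] by (intro sum_mono) (auto simp: abs_mult intro!: mult_right_mono)
    finally show ?thesis .
  qed
  \<comment> \<open>Error of replacing \<open>T\<close> by \<open>p\<close>. The mass-sensitive
    bound \<open>T_fine\<close> matters: the masses \<open>V\<close> and \<open>F\<close> of the
    test functions are small on average, which gains the factor \<open>\<rho> * p\<close> over the
    bound for test functions of size 1.\<close>
  have C1: "(\<Sum>z\<in>Z. \<Sum>x\<in>X. (T z x - p) * (h z x)\<^sup>2) \<le> 5 * \<gamma> * p ^ 4 * \<rho> * n * a * b\<^sup>2"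
  proof -
    define F where "F y y' = (\<Sum>x\<in>X. \<bar>f x y * f x y'\<bar>)" for y y'
    define V where "V y y' = (\<Sum>z\<in>Z. \<bar>v z y * v z y'\<bar>)" for y y'
    have F0: "0 \<le> F y y'" and V0: "0 \<le> V y y'" for y y'
      by (auto simp: F_def V_def intro: sum_nonneg)
    have F_sum: "(\<Sum>y\<in>Y. \<Sum>y'\<in>Y. F y y') \<le> 8 * p\<^sup>2 * a * b\<^sup>2"
    proof -
      have "(\<Sum>y\<in>Y. \<Sum>y'\<in>Y. F y y') = (\<Sum>y\<in>Y. \<Sum>x\<in>X. \<Sum>y'\<in>Y. \<bar>f x y * f x y'\<bar>)"
        unfolding F_def by (intro sum.cong refl sum.swap)
      also have "\<dots> = (\<Sum>x\<in>X. (\<Sum>y\<in>Y. \<bar>f x y\<bar>)\<^sup>2)"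
        by (subst sum.swap) (simp add: power2_eq_square sum_product abs_mult)
      also have "\<dots> \<le> (\<Sum>x\<in>X. (\<Sum>y\<in>Y. S x y + p)\<^sup>2)"
        by (intro sum_mono power_mono f_le sum_nonneg) auto
      finally show ?thesis using majorant_square_le by linarith
    qed
    have V_sum: "(\<Sum>y\<in>Y. \<Sum>y'\<in>Y. V y y') \<le> 3 * \<rho>\<^sup>2 * n * b\<^sup>2"
    proof -
      have "(\<Sum>y\<in>Y. \<Sum>y'\<in>Y. V y y') = (\<Sum>y\<in>Y. \<Sum>z\<in>Z. \<Sum>y'\<in>Y. \<bar>v z y * v z y'\<bar>)"
        unfolding V_def by (intro sum.cong refl sum.swap)
      also have "\<dots> = (\<Sum>z\<in>Z. (\<Sum>y\<in>Y. \<bar>v z y\<bar>)\<^sup>2)"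
        by (subst sum.swap) (simp add: power2_eq_square sum_product abs_mult)
      also have "\<dots> \<le> (\<Sum>z\<in>Z. (\<Sum>y\<in>Y. W z y)\<^sup>2)"
        using v by (intro sum_mono power_mono sum_nonneg) auto
      finally show ?thesis using W.sum_square_le by linarith
    qed
    have "(\<Sum>y\<in>Y. \<Sum>y'\<in>Y. sqrt (V y y') * sqrt (F y y'))\<^sup>2 \<le>
        (\<Sum>y\<in>Y. \<Sum>y'\<in>Y. (sqrt (V y y'))\<^sup>2) * (\<Sum>y\<in>Y. \<Sum>y'\<in>Y. (sqrt (F y y'))\<^sup>2)"
      unfolding sum.cartesian_product split_def by (rule Cauchy_Schwarz_ineq_sum)
    also have "\<dots> = (\<Sum>y\<in>Y. \<Sum>y'\<in>Y. V y y') * (\<Sum>y\<in>Y. \<Sum>y'\<in>Y. F y y')"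
      using F0 V0 by simp
    also have "\<dots> \<le> (3 * \<rho>\<^sup>2 * n * b\<^sup>2) * (8 * p\<^sup>2 * a * b\<^sup>2)"
      by (intro mult_mono V_sum F_sum) (auto intro: sum_nonneg F0)
    also have "\<dots> = 24 * (n * a * (\<rho> * p * b\<^sup>2)\<^sup>2)"
      by (simp add: power2_eq_square)
    \<comment> \<open>Rounded up to a perfect square.\<close>
    also have "\<dots> \<le> 25 * (n * a * (\<rho> * p * b\<^sup>2)\<^sup>2)"
      by (intro mult_right_mono) auto
    also have "\<dots> = (5 * \<rho> * p * b\<^sup>2 * sqrt (n * a))\<^sup>2"
      by (simp add: power_mult_distrib)
    finally have CS: "(\<Sum>y\<in>Y. \<Sum>y'\<in>Y. sqrt (V y y') * sqrt (F y y')) \<le> 5 * \<rho> * p * b\<^sup>2 * sqrt (n * a)"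
      by (rule power2_le_imp_le) (use W.r p_pos in auto)
    have "(\<Sum>z\<in>Z. \<Sum>x\<in>X. (T z x - p) * (h z x)\<^sup>2) =
        (\<Sum>z\<in>Z. \<Sum>x\<in>X. (T z x - p) * (\<Sum>y\<in>Y. v z y * f x y)\<^sup>2)"
      by (simp add: h_def mult.commute)
    also have "\<dots> = (\<Sum>y\<in>Y. \<Sum>y'\<in>Y. \<Sum>z\<in>Z. \<Sum>x\<in>X. (T z x - p) * (v z y * v z y') * (f x y * f x y'))"
      by (rule sum_kernel_square)
    also have "\<dots> \<le> (\<Sum>y\<in>Y. \<Sum>y'\<in>Y. \<gamma> * p ^ 3 * sqrt (n * a) * (sqrt (V y y') * sqrt (F y y')))"
      unfolding V_def F_def
      by (intro sum_mono order_trans[OF abs_ge_self T_fine] abs_prod_le1 v1 f_le)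
    also have "\<dots> = \<gamma> * p ^ 3 * sqrt (n * a) * (\<Sum>y\<in>Y. \<Sum>y'\<in>Y. sqrt (V y y') * sqrt (F y y'))"
      by (simp add: sum_distrib_left)
    also have "\<dots> \<le> \<gamma> * p ^ 3 * sqrt (n * a) * (5 * \<rho> * p * b\<^sup>2 * sqrt (n * a))"
      using \<gamma> p_pos by (intro mult_left_mono CS) auto
    also have "\<dots> = 5 * \<gamma> * p ^ 4 * \<rho> * (sqrt (n * a) * sqrt (n * a)) * b\<^sup>2"
      by (simp only: power3_eq_cube power4_eq_xxxx mult_ac)
    also have "\<dots> = 5 * \<gamma> * p ^ 4 * \<rho> * n * a * b\<^sup>2"
      by (simp add: mult_ac)
    finally show ?thesis .
  qed
  \<comment> \<open>Without the weight \<open>T\<close>, the sum over \<open>x\<close> produces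
    codegrees of \<open>f\<close>. Once these are replaced by their absolute values, the nonnegative
    \<open>v\<close> may be replaced by its majorant \<open>W\<close>.\<close>
  have C2: "(\<Sum>z\<in>Z. \<Sum>x\<in>X. (h z x)\<^sup>2) \<le> (\<delta> + 6 * \<gamma>) * p\<^sup>2 * \<rho>\<^sup>2 * n * a * b\<^sup>2"
  proof -
    have codeg: "(\<Sum>y\<in>Y. \<Sum>y'\<in>Y. \<bar>codeg y y'\<bar>) \<le> \<delta> * (p\<^sup>2 * a * b\<^sup>2)"
    proof (rule power2_le_imp_le)
      show "(\<Sum>y\<in>Y. \<Sum>y'\<in>Y. \<bar>codeg y y'\<bar>)\<^sup>2 \<le> (\<delta> * (p\<^sup>2 * a * b\<^sup>2))\<^sup>2"
        using codeg_sum_le \<gamma> e by (simp add: power_mult_distrib \<delta>_def)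
    qed (use \<delta>0 in auto)
    have "(\<Sum>z\<in>Z. \<Sum>x\<in>X. (h z x)\<^sup>2) = (\<Sum>z\<in>Z. \<Sum>x\<in>X. 1 * (\<Sum>y\<in>Y. v z y * f x y)\<^sup>2)"
      by (simp add: h_def mult.commute)
    also have "\<dots> = (\<Sum>y\<in>Y. \<Sum>y'\<in>Y. \<Sum>z\<in>Z. \<Sum>x\<in>X. 1 * (v z y * v z y') * (f x y * f x y'))"
      by (rule sum_kernel_square)
    also have "\<dots> = (\<Sum>y\<in>Y. \<Sum>y'\<in>Y. codeg y y' * (\<Sum>z\<in>Z. v z y * v z y'))"
      by (subst sum.swap[where A=Z and B=X]) (simp add: codeg_def sum_product mult_ac)
    also have "\<dots> \<le> (\<Sum>y\<in>Y. \<Sum>y'\<in>Y. \<bar>codeg y y'\<bar> * (\<Sum>z\<in>Z. W z y * W z y'))"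
    proof (intro sum_mono mult_mono)
      show "v z y \<le> W z y" "0 \<le> W z y" "0 \<le> v z y" if "z \<in> Z" "y \<in> Y" for z y
        using v[OF that] by auto
    qed (use v in \<open>auto intro!: sum_nonneg mult_nonneg_nonneg\<close>)
    also have "\<dots> \<le> \<rho>\<^sup>2 * n * (\<delta> * (p\<^sup>2 * a * b\<^sup>2)) + 6 * \<gamma> * p ^ 4 * a * b\<^sup>2 * n"
      by (rule order_trans[OF codeg_W_sum_le]) (intro add_mono mult_left_mono codeg order_refl, simp)
    also have "\<dots> \<le> \<rho>\<^sup>2 * n * (\<delta> * (p\<^sup>2 * a * b\<^sup>2)) + 6 * \<gamma> * (p\<^sup>2 * \<rho>\<^sup>2) * a * b\<^sup>2 * n"
    proof -
      have "p\<^sup>2 \<le> \<rho>\<^sup>2" using p_le p_pos by (intro power_mono) auto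
      then have "p ^ 4 \<le> p\<^sup>2 * \<rho>\<^sup>2"
        using mult_left_mono[of "p\<^sup>2" "\<rho>\<^sup>2" "p\<^sup>2"] by (simp flip: power_add)
      then show ?thesis using \<gamma> by (intro add_left_mono mult_right_mono mult_left_mono) auto
    qed
    also have "\<dots> = (\<delta> + 6 * \<gamma>) * p\<^sup>2 * \<rho>\<^sup>2 * n * a * b\<^sup>2"
      by (simp add: algebra_simps)
    finally show ?thesis .
  qed
  have main: "(\<Sum>z\<in>Z. \<Sum>x\<in>X. T z x * \<bar>h z x\<bar>\<^sup>2) \<le> (11 * \<gamma> + \<delta>) * (p ^ 3 * \<rho>\<^sup>2 * n * a * b\<^sup>2)"
  proof -
    have "(\<Sum>z\<in>Z. \<Sum>x\<in>X. T z x * \<bar>h z x\<bar>\<^sup>2) =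
        (\<Sum>z\<in>Z. \<Sum>x\<in>X. (T z x - p) * (h z x)\<^sup>2) + p * (\<Sum>z\<in>Z. \<Sum>x\<in>X. (h z x)\<^sup>2)"
      by (simp add: sum_distrib_left sum.distrib[symmetric] algebra_simps)
    also have "\<dots> \<le> 5 * \<gamma> * p ^ 4 * \<rho> * n * a * b\<^sup>2 + p * ((\<delta> + 6 * \<gamma>) * p\<^sup>2 * \<rho>\<^sup>2 * n * a * b\<^sup>2)"
      using C1 C2 p_pos by (intro add_mono mult_left_mono) auto
    also have "\<dots> \<le> 5 * \<gamma> * (p ^ 3 * \<rho>\<^sup>2) * n * a * b\<^sup>2 + p * ((\<delta> + 6 * \<gamma>) * p\<^sup>2 * \<rho>\<^sup>2 * n * a * b\<^sup>2)"
    proof -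
      have "p ^ 4 * \<rho> \<le> p ^ 3 * \<rho>\<^sup>2"
        using mult_left_mono[OF p_le, of "p ^ 3 * \<rho>"] p_pos W.r
        by (simp add: power2_eq_square power3_eq_cube power4_eq_xxxx mult_ac)
      then have "5 * \<gamma> * (p ^ 4 * \<rho>) * n * a * b\<^sup>2 \<le> 5 * \<gamma> * (p ^ 3 * \<rho>\<^sup>2) * n * a * b\<^sup>2"
        using \<gamma> by (intro mult_right_mono mult_left_mono) auto
      then show ?thesis by (simp add: mult.assoc)
    qed
    also have "\<dots> = (11 * \<gamma> + \<delta>) * (p ^ 3 * \<rho>\<^sup>2 * n * a * b\<^sup>2)"
      by (simp add: power2_eq_square power3_eq_cube algebra_simps)
    finally show ?thesis .
  qed
  have "(\<Sum>z\<in>Z. \<bar>\<Sum>x\<in>X. \<Sum>y\<in>Y. f x y * u z x * v z y\<bar>)\<^sup>2 \<le> (\<Sum>z\<in>Z. \<Sum>x\<in>X. T z x * \<bar>h z x\<bar>)\<^sup>2"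
    by (intro power_mono sum_mono le sum_nonneg) auto
  also have "\<dots> \<le> (\<Sum>z\<in>Z. \<Sum>x\<in>X. T z x) * (\<Sum>z\<in>Z. \<Sum>x\<in>X. T z x * \<bar>h z x\<bar>\<^sup>2)"
    using T.range by (intro weighted_Cauchy_Schwarz) auto
  also have "\<dots> \<le> (2 * p * n * a) * ((11 * \<gamma> + \<delta>) * (p ^ 3 * \<rho>\<^sup>2 * n * a * b\<^sup>2))"
    using T.range p_pos by (intro mult_mono T.sum_le main sum_nonneg mult_nonneg_nonneg) auto
  also have "\<dots> = (22 * \<gamma> + 2 * \<delta>) * (p\<^sup>2 * \<rho> * a * b * n)\<^sup>2"
    by (simp add: power2_eq_square power3_eq_cube algebra_simps)
  finally show ?thesis unfolding \<delta>_def .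
qed

end

section \<open>Signed test functions, and regularity inherited by neighbourhoods\<close>

lemma unit_interval_funI:
  fixes u u' :: "'a \<Rightarrow> real"
  assumes "\<And>x. x \<in> X \<Longrightarrow> 0 \<le> u' x \<and> u' x \<le> \<bar>u x\<bar>" "\<And>x. x \<in> X \<Longrightarrow> \<bar>u x\<bar> \<le> 1"
  shows "u' \<in> X \<rightarrow> {0..1}"
  using assms by (fastforce intro: order_trans)

lemma jumbled_signed:
  assumes j: "jumbled k X Y p \<beta>" and \<beta>: "0 \<le> \<beta>"
    and u: "\<And>x. x \<in> X \<Longrightarrow> \<bar>u x\<bar> \<le> 1" and v: "\<And>y. y \<in> Y \<Longrightarrow> \<bar>v y\<bar> \<le> 1"
  shows "\<bar>\<Sum>x\<in>X. \<Sum>y\<in>Y. (k x y - p) * u x * v y\<bar> \<le>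
    4 * (\<beta> * sqrt (\<Sum>x\<in>X. \<bar>u x\<bar>) * sqrt (\<Sum>y\<in>Y. \<bar>v y\<bar>))"
proof (rule signed_kernel_bound)
  fix u' v'
  assume u': "\<And>x. x \<in> X \<Longrightarrow> 0 \<le> u' x \<and> u' x \<le> \<bar>u x\<bar>"
    and v': "\<And>y. y \<in> Y \<Longrightarrow> 0 \<le> v' y \<and> v' y \<le> \<bar>v y\<bar>"
  have "u' \<in> X \<rightarrow> {0..1}" "v' \<in> Y \<rightarrow> {0..1}"
    using unit_interval_funI[of X u' u] unit_interval_funI[of Y v' v] u u' v v' by blast+
  then have "\<bar>\<Sum>x\<in>X. \<Sum>y\<in>Y. (k x y - p) * u' x * v' y\<bar> \<le> \<beta> * sqrt (sum u' X) * sqrt (sum v' Y)"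
    using j unfolding jumbled_def by blast
  also have "\<dots> \<le> \<beta> * sqrt (\<Sum>x\<in>X. \<bar>u x\<bar>) * sqrt (\<Sum>y\<in>Y. \<bar>v y\<bar>)"
    using u' v' \<beta>
    by (intro mult_mono mult_left_mono real_sqrt_le_mono sum_mono mult_nonneg_nonneg
        real_sqrt_ge_zero sum_nonneg) auto
  finally show "\<bar>\<Sum>x\<in>X. \<Sum>y\<in>Y. (k x y - p) * u' x * v' y\<bar> \<le> \<dots>" .
qed

lemma DISC_sum_le:
  assumes "DISC G X Y q p \<epsilon>" "finite X" "finite Y" "X \<noteq> {}" "Y \<noteq> {}"
    and "u \<in> X \<rightarrow> {0..1}" "v \<in> Y \<rightarrow> {0..1}"
  shows "\<bar>\<Sum>x\<in>X. \<Sum>y\<in>Y. (G x y - q) * u x * v y\<bar> \<le> \<epsilon> * p * card X * card Y"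
proof -
  have "real (card X) * card Y > 0"
    using assms by (simp add: card_gt_0_iff)
  moreover have "\<bar>1 / (real (card X) * card Y) * (\<Sum>x\<in>X. \<Sum>y\<in>Y. (G x y - q) * u x * v y)\<bar> \<le> \<epsilon> * p"
    using assms unfolding DISC_def by blast
  ultimately show ?thesis
    by (simp add: abs_mult abs_divide divide_le_eq mult.assoc)
qed

lemma DISC_signed:
  assumes "DISC G X Y q p \<epsilon>" "finite X" "finite Y" "X \<noteq> {}" "Y \<noteq> {}"
    and u: "\<And>x. x \<in> X \<Longrightarrow> \<bar>u x\<bar> \<le> 1" and v: "\<And>y. y \<in> Y \<Longrightarrow> \<bar>v y\<bar> \<le> 1"
  shows "\<bar>\<Sum>x\<in>X. \<Sum>y\<in>Y. (G x y - q) * u x * v y\<bar> \<le> 4 * (\<epsilon> * p * card X * card Y)"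
proof (rule signed_kernel_bound)
  fix u' v'
  assume u': "\<And>x. x \<in> X \<Longrightarrow> 0 \<le> u' x \<and> u' x \<le> \<bar>u x\<bar>"
    and v': "\<And>y. y \<in> Y \<Longrightarrow> 0 \<le> v' y \<and> v' y \<le> \<bar>v y\<bar>"
  then have "u' \<in> X \<rightarrow> {0..1}" "v' \<in> Y \<rightarrow> {0..1}"
    using unit_interval_funI[of X u' u] unit_interval_funI[of Y v' v] u u' v v' by blast+
  with assms show "\<bar>\<Sum>x\<in>X. \<Sum>y\<in>Y. (G x y - q) * u' x * v' y\<bar> \<le> \<epsilon> * p * card X * card Y"
    by (intro DISC_sum_le)
qed

text \<open>Test functions bounded by 1 have mass at most the size of the set, so the square roots
  combine with \<open>sqrt (real (card A) * card B)\<close> to the product of the sizes. The error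
  is measured in \<open>p\<close> but the density is any \<open>r \<ge> p\<close>, so as to cover
  the constant kernel of density 1.\<close>

lemma jumbled_kernel:
  assumes "finite A" "finite B" "\<And>x y. x \<in> A \<Longrightarrow> y \<in> B \<Longrightarrow> 0 \<le> k x y \<and> k x y \<le> 1"
    and p: "0 < p" "p \<le> r" "r \<le> 1" and c: "0 \<le> c" "4 * c \<le> 1"
    and j: "jumbled k A B r (c * p ^ 3 * sqrt (real (card A) * card B))"
  shows "kernel k A B r (4 * c * p ^ 3)"
proof
  have "4 * c * p ^ 3 \<le> 1 * p\<^sup>2"
    using c p by (intro mult_mono power_decreasing) auto
  also have "\<dots> \<le> r\<^sup>2"
    using p by (simp add: power_mono)
  finally show "4 * c * p ^ 3 \<le> r\<^sup>2" .
  fix u v :: "_ \<Rightarrow> real"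
  assume u: "\<And>x. x \<in> A \<Longrightarrow> \<bar>u x\<bar> \<le> 1" and v: "\<And>y. y \<in> B \<Longrightarrow> \<bar>v y\<bar> \<le> 1"
  let ?\<beta> = "c * p ^ 3 * sqrt (real (card A) * card B)"
  have \<beta>: "0 \<le> ?\<beta>" using c p by simp
  have "(\<Sum>x\<in>A. \<bar>u x\<bar>) \<le> card A" "(\<Sum>y\<in>B. \<bar>v y\<bar>) \<le> card B"
    using sum_mono[of A "\<lambda>x. \<bar>u x\<bar>" "\<lambda>_. 1"] sum_mono[of B "\<lambda>x. \<bar>v x\<bar>" "\<lambda>_. 1"] u v by auto
  then have "4 * (?\<beta> * sqrt (\<Sum>x\<in>A. \<bar>u x\<bar>) * sqrt (\<Sum>y\<in>B. \<bar>v y\<bar>)) \<le>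
      4 * (?\<beta> * sqrt (card A) * sqrt (card B))"
    using \<beta> by (intro mult_left_mono mult_mono real_sqrt_le_mono) (auto intro: sum_nonneg)
  also have "\<dots> = 4 * c * p ^ 3 * (sqrt (real (card A)) * sqrt (real (card A))) *
      (sqrt (real (card B)) * sqrt (real (card B)))"
    by (simp only: real_sqrt_mult mult_ac)
  also have "\<dots> = 4 * c * p ^ 3 * card A * card B"
    by simp
  finally show "\<bar>\<Sum>x\<in>A. \<Sum>y\<in>B. (k x y - r) * u x * v y\<bar> \<le> 4 * c * p ^ 3 * card A * card B"
    by (rule order_trans[rotated]) (rule jumbled_signed[OF j \<beta>]; fact u v)
qed (use assms in auto)

text \<open>A Markov argument: every exceptional \<open>z\<close> provides test functions below
  \<open>T z\<close> and \<open>W z\<close> on which \<open>f = G - q\<close> is large, while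
  \<open>local_discrepancy_sum_le\<close> bounds the sum over all \<open>z\<close>. Arbitrary large
  subsets \<open>X'\<close>, \<open>Y'\<close> are allowed because the sets of interest are
  neighbourhoods in \<open>G\<close>, whereas \<open>T\<close> and \<open>W\<close> describe the
  jumbled host graph.\<close>

lemma card_not_inheriting_le:
  fixes S :: "'a \<Rightarrow> 'b \<Rightarrow> real" and T :: "'c \<Rightarrow> 'a \<Rightarrow> real" and W :: "'c \<Rightarrow> 'b \<Rightarrow> real"
    and p \<rho> :: real
  assumes fin: "finite X" "finite Y" "finite Z" and ne: "X \<noteq> {}" "Y \<noteq> {}"
    and p: "0 < p" "p \<le> \<rho>" "\<rho> \<le> 1"
    and c: "0 \<le> c" "c \<le> \<delta> ^ 4 / 5000" and \<epsilon>: "0 \<le> \<epsilon>" "\<epsilon> \<le> \<delta> ^ 4 / 5000"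
    and \<delta>: "0 < \<delta>" "\<delta> \<le> 1" and s: "0 < s" and \<epsilon>': "0 < \<epsilon>'"
    and S: "\<And>x y. 0 \<le> S x y \<and> S x y \<le> 1" and T: "\<And>z x. 0 \<le> T z x \<and> T z x \<le> 1"
    and W: "\<And>z y. 0 \<le> W z y \<and> W z y \<le> 1"
    and G: "\<And>x y. 0 \<le> G x y \<and> G x y \<le> S x y" and q: "0 \<le> q" "q \<le> p"
    and jS: "jumbled S X Y p (c * p ^ 3 * sqrt (real (card X) * card Y))"
    and jT: "jumbled T Z X p (c * p ^ 3 * sqrt (real (card Z) * card X))"
    and jW: "jumbled W Z Y \<rho> (c * p ^ 3 * sqrt (real (card Z) * card Y))"
    and disc: "DISC G X Y q p \<epsilon>"
  shows "card {z \<in> Z. \<exists>X' Y'. X' \<subseteq> {x \<in> X. T z x = 1} \<and> Y' \<subseteq> {y \<in> Y. W z y = 1} \<and>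
      s * p * card X \<le> card X' \<and> s * \<rho> * card Y \<le> card Y' \<and> \<not> DISC G X' Y' q p \<epsilon>'}
    \<le> \<delta> / (s\<^sup>2 * \<epsilon>') * card Z"
    (is "real (card ?B) \<le> _")
proof -
  define f where "f x y = G x y - q" for x y
  have \<delta>4: "\<delta> ^ 4 \<le> 1" "\<delta> ^ 4 \<le> \<delta>\<^sup>2"
    using \<delta> by (auto intro: power_le_one power_decreasing)
  then have c4: "4 * c \<le> 1" using c by linarith
  interpret regular_triple S T W X Y Z p \<rho> "4 * c" f "4 * \<epsilon>"
  proof (intro regular_triple.intro regular_triple_axioms.intro)
    show "kernel S X Y p (4 * c * p ^ 3)" "kernel T Z X p (4 * c * p ^ 3)"
      using assms c4 by (auto intro!: jumbled_kernel)
    show "kernel W Z Y \<rho> (4 * c * p ^ 3)"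
      using assms c4 by (intro jumbled_kernel) auto
    show "\<bar>\<Sum>z\<in>Z. \<Sum>x\<in>X. (T z x - p) * u z * v x\<bar>
        \<le> 4 * c * p ^ 3 * sqrt (real (card Z) * real (card X)) *
          (sqrt (\<Sum>z\<in>Z. \<bar>u z\<bar>) * sqrt (\<Sum>x\<in>X. \<bar>v x\<bar>))"
      if "\<And>z. z \<in> Z \<Longrightarrow> \<bar>u z\<bar> \<le> 1" "\<And>x. x \<in> X \<Longrightarrow> \<bar>v x\<bar> \<le> 1" for u v
      using jumbled_signed[OF jT, of u v] that c p by (simp add: mult_ac)
    show "\<bar>\<Sum>x\<in>X. \<Sum>y\<in>Y. f x y * u x * v y\<bar> \<le> 4 * \<epsilon> * p * card X * card Y"
      if "\<And>x. x \<in> X \<Longrightarrow> \<bar>u x\<bar> \<le> 1" "\<And>y. y \<in> Y \<Longrightarrow> \<bar>v y\<bar> \<le> 1" for u v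
      using DISC_signed[OF disc fin(1,2) ne, of u v] that unfolding f_def by simp
    show "\<bar>f x y\<bar> \<le> 1" "\<bar>f x y\<bar> \<le> S x y + p" for x y
      using G[of x y] S[of x y] q p by (auto simp: f_def)
  qed (use ne c c4 p \<epsilon> in auto)
  have a: "0 < a" and b: "0 < b"
    using ne fin by (auto simp: card_gt_0_iff)
  \<comment> \<open>The lower bound is \<open>\<epsilon>' * p\<close> times the smallest admissible
    product of sizes, \<open>(s * p * a) * (s * \<rho> * b)\<close>.\<close>
  define P where "P z u v \<longleftrightarrow> (\<forall>x\<in>X. 0 \<le> u x \<and> u x \<le> T z x) \<and> (\<forall>y\<in>Y. 0 \<le> v y \<and> v y \<le> W z y) \<and>
      \<epsilon>' * s\<^sup>2 * (p\<^sup>2 * \<rho> * a * b) \<le> \<bar>\<Sum>x\<in>X. \<Sum>y\<in>Y. f x y * u x * v y\<bar>"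
    for z u v
  define B where "B = ?B"
  have B_sub: "B \<subseteq> Z" by (auto simp: B_def)
  have "\<exists>u v. P z u v" if zB: "z \<in> B" for z
  proof -
    obtain X' Y' where sub: "X' \<subseteq> {x \<in> X. T z x = 1}" "Y' \<subseteq> {y \<in> Y. W z y = 1}"
      and sz: "s * p * a \<le> card X'" "s * \<rho> * b \<le> card Y'" and nd: "\<not> DISC G X' Y' q p \<epsilon>'"
      using zB unfolding B_def by blast
    from nd obtain u v where uv: "u \<in> X' \<rightarrow> {0..1}" "v \<in> Y' \<rightarrow> {0..1}"
      and big: "\<epsilon>' * p < \<bar>1 / (real (card X') * card Y') * (\<Sum>x\<in>X'. \<Sum>y\<in>Y'. (G x y - q) * u x * v y)\<bar>"
      unfolding DISC_def not_le[symmetric] by blast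
    define u0 where "u0 x = (if x \<in> X' then u x else 0)" for x
    define v0 where "v0 y = (if y \<in> Y' then v y else 0)" for y
    have pos: "0 < s * p * a" "0 < s * \<rho> * b"
      using s p a b by auto
    then have pos': "0 < real (card X') * card Y'"
      using sz by (intro mult_pos_pos) linarith+
    have "(\<Sum>x\<in>X'. \<Sum>y\<in>Y'. (G x y - q) * u x * v y) = (\<Sum>x\<in>X. \<Sum>y\<in>Y. f x y * u0 x * v0 y)"
    proof -
      have "(\<Sum>x\<in>X'. \<Sum>y\<in>Y'. (G x y - q) * u x * v y) = (\<Sum>x\<in>X'. \<Sum>y\<in>Y. f x y * u0 x * v0 y)"
        using sub fin by (intro sum.cong refl sum.mono_neutral_cong_left) (auto simp: f_def u0_def v0_def)
      also have "\<dots> = (\<Sum>x\<in>X. \<Sum>y\<in>Y. f x y * u0 x * v0 y)"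
        using sub fin by (intro sum.mono_neutral_left) (auto simp: u0_def)
      finally show ?thesis .
    qed
    with big pos' have "\<epsilon>' * p * (real (card X') * card Y') < \<bar>\<Sum>x\<in>X. \<Sum>y\<in>Y. f x y * u0 x * v0 y\<bar>"
      by (simp add: abs_divide less_divide_eq)
    moreover have "\<epsilon>' * p * ((s * p * a) * (s * \<rho> * b)) \<le> \<epsilon>' * p * (real (card X') * card Y')"
      using sz pos \<epsilon>' p by (intro mult_left_mono mult_mono) auto
    ultimately have "\<epsilon>' * s\<^sup>2 * (p\<^sup>2 * \<rho> * a * b) \<le> \<bar>\<Sum>x\<in>X. \<Sum>y\<in>Y. f x y * u0 x * v0 y\<bar>"
      by (simp add: power2_eq_square mult_ac)
    moreover have "0 \<le> u0 x \<and> u0 x \<le> T z x" for x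
    proof (cases "x \<in> X'")
      case True
      then have "T z x = 1" "u x \<in> {0..1}" using sub uv by auto
      with True show ?thesis by (simp add: u0_def)
    qed (use T in \<open>simp add: u0_def\<close>)
    moreover have "0 \<le> v0 y \<and> v0 y \<le> W z y" for y
    proof (cases "y \<in> Y'")
      case True
      then have "W z y = 1" "v y \<in> {0..1}" using sub uv by auto
      with True show ?thesis by (simp add: v0_def)
    qed (use W in \<open>simp add: v0_def\<close>)
    ultimately show ?thesis unfolding P_def by blast
  qed
  then obtain u v where uv: "\<And>z. z \<in> B \<Longrightarrow> P z (u z) (v z)"
    by metis
  \<comment> \<open>Zero outside \<open>B\<close>, so that the domination by \<open>T\<close> and
    \<open>W\<close> holds for all \<open>z\<close> in \<open>Z\<close>.\<close>
  define u' where "u' z x = (if z \<in> B then u z x else 0)" for z x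
  define v' where "v' z y = (if z \<in> B then v z y else 0)" for z y
  have "(\<Sum>z\<in>Z. \<bar>\<Sum>x\<in>X. \<Sum>y\<in>Y. f x y * u' z x * v' z y\<bar>)\<^sup>2 \<le>
      (22 * (4 * c) + 2 * sqrt (57 * (4 * c) + 18 * (4 * \<epsilon>))) * (p\<^sup>2 * \<rho> * a * b * n)\<^sup>2"
    using uv T W unfolding P_def by (intro local_discrepancy_sum_le) (simp_all add: u'_def v'_def)
  also have "\<dots> \<le> \<delta>\<^sup>2 * (p\<^sup>2 * \<rho> * a * b * n)\<^sup>2"
  proof (intro mult_right_mono)
    \<comment> \<open>Source of the constant 5000: the left side is at most
      \<open>300 * \<delta> ^ 4 / 5000\<close>, and 300 / 5000 is below 1 / 16.\<close>
    have "57 * (4 * c) + 18 * (4 * \<epsilon>) \<le> (\<delta>\<^sup>2 / 4)\<^sup>2"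
      using c \<epsilon> by (simp add: power2_eq_square power4_eq_xxxx)
    then have "sqrt (57 * (4 * c) + 18 * (4 * \<epsilon>)) \<le> \<delta>\<^sup>2 / 4"
      by (intro real_le_lsqrt) auto
    moreover have "22 * (4 * c) \<le> \<delta>\<^sup>2 / 2"
      using c \<delta>4 by linarith
    ultimately show "22 * (4 * c) + 2 * sqrt (57 * (4 * c) + 18 * (4 * \<epsilon>)) \<le> \<delta>\<^sup>2"
      by linarith
  qed simp
  finally have "(\<Sum>z\<in>Z. \<bar>\<Sum>x\<in>X. \<Sum>y\<in>Y. f x y * u' z x * v' z y\<bar>)\<^sup>2 \<le> (\<delta> * (p\<^sup>2 * \<rho> * a * b * n))\<^sup>2"
    by (simp add: power_mult_distrib)
  then have upper: "(\<Sum>z\<in>Z. \<bar>\<Sum>x\<in>X. \<Sum>y\<in>Y. f x y * u' z x * v' z y\<bar>) \<le> \<delta> * (p\<^sup>2 * \<rho> * a * b * n)"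
    by (rule power2_le_imp_le) (use \<delta> p in auto)
  have "card B * (\<epsilon>' * s\<^sup>2 * (p\<^sup>2 * \<rho> * a * b)) = (\<Sum>z\<in>B. \<epsilon>' * s\<^sup>2 * (p\<^sup>2 * \<rho> * a * b))"
    by simp
  also have "\<dots> \<le> (\<Sum>z\<in>B. \<bar>\<Sum>x\<in>X. \<Sum>y\<in>Y. f x y * u' z x * v' z y\<bar>)"
    using uv unfolding P_def by (intro sum_mono) (simp add: u'_def v'_def)
  also have "\<dots> \<le> (\<Sum>z\<in>Z. \<bar>\<Sum>x\<in>X. \<Sum>y\<in>Y. f x y * u' z x * v' z y\<bar>)"
    using fin B_sub by (intro sum_mono2) auto
  also note upper
  finally have "(real (card B) * (\<epsilon>' * s\<^sup>2)) * (p\<^sup>2 * \<rho> * a * b) \<le> (\<delta> * n) * (p\<^sup>2 * \<rho> * a * b)"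
    by (simp only: mult_ac)
  moreover have "0 < p\<^sup>2 * \<rho> * a * b"
    using p a b by simp
  ultimately have "real (card B) * (\<epsilon>' * s\<^sup>2) \<le> \<delta> * n"
    by (rule mult_right_le_imp_le)
  then show ?thesis
    unfolding B_def[symmetric] using s \<epsilon>' by (simp add: field_simps)
qed

subsection \<open>Vertex-by-vertex counting\<close>

text \<open>Extending test functions by zero changes neither the sum nor their masses. So
  jumbledness passes to subsets with the same absolute \<beta>; only its size relative to the sets
  deteriorates.\<close>

lemma jumbled_mono:
  assumes j: "jumbled k X Y p \<beta>" and sub: "X' \<subseteq> X" "Y' \<subseteq> Y" and fin: "finite X" "finite Y" and le: "\<beta> \<le> \<beta>'"
  shows "jumbled k X' Y' p \<beta>'"
  unfolding jumbled_def
proof (intro ballI)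
  fix u v assume u: "u \<in> X' \<rightarrow> {0..1::real}" and v: "v \<in> Y' \<rightarrow> {0..1::real}"
  define u0 where "u0 x = (if x \<in> X' then u x else 0)" for x
  define v0 where "v0 y = (if y \<in> Y' then v y else 0)" for y
  have "u0 \<in> X \<rightarrow> {0..1}" "v0 \<in> Y \<rightarrow> {0..1}"
    using u v by (auto simp: u0_def v0_def)
  then have "\<bar>\<Sum>x\<in>X. \<Sum>y\<in>Y. (k x y - p) * u0 x * v0 y\<bar> \<le> \<beta> * sqrt (sum u0 X) * sqrt (sum v0 Y)"
    using j unfolding jumbled_def by blast
  moreover have "(\<Sum>x\<in>X'. \<Sum>y\<in>Y'. (k x y - p) * u x * v y) = (\<Sum>x\<in>X. \<Sum>y\<in>Y. (k x y - p) * u0 x * v0 y)"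
  proof -
    have "(\<Sum>x\<in>X'. \<Sum>y\<in>Y'. (k x y - p) * u x * v y) = (\<Sum>x\<in>X'. \<Sum>y\<in>Y. (k x y - p) * u0 x * v0 y)"
      using sub fin by (intro sum.cong refl sum.mono_neutral_cong_left) (auto simp: u0_def v0_def)
    also have "\<dots> = (\<Sum>x\<in>X. \<Sum>y\<in>Y. (k x y - p) * u0 x * v0 y)"
      using sub fin by (intro sum.mono_neutral_left) (auto simp: u0_def)
    finally show ?thesis .
  qed
  moreover have "sum u0 X = sum u X'" "sum v0 Y = sum v Y'"
    using sub fin by (auto simp: u0_def v0_def intro!: sum.mono_neutral_cong_right)
  moreover have "\<beta> * (sqrt (sum u X') * sqrt (sum v Y')) \<le> \<beta>' * (sqrt (sum u X') * sqrt (sum v Y'))"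
    using u v by (intro mult_right_mono le mult_nonneg_nonneg real_sqrt_ge_zero sum_nonneg) auto
  ultimately show "\<bar>\<Sum>x\<in>X'. \<Sum>y\<in>Y'. (k x y - p) * u x * v y\<bar> \<le> \<beta>' * sqrt (sum u X') * sqrt (sum v Y')"
    by (simp add: mult.assoc)
qed

lemma jumbled_swap:
  assumes "jumbled k X Y p \<beta>"
  shows "jumbled (\<lambda>y x. k x y) Y X p \<beta>"
  unfolding jumbled_def
proof (intro ballI)
  fix u v assume uv: "u \<in> Y \<rightarrow> {0..1::real}" "v \<in> X \<rightarrow> {0..1::real}"
  have "(\<Sum>y\<in>Y. \<Sum>x\<in>X. (k x y - p) * u y * v x) = (\<Sum>x\<in>X. \<Sum>y\<in>Y. (k x y - p) * v x * u y)"
    by (subst sum.swap) (simp add: mult_ac)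
  moreover have "\<bar>\<Sum>x\<in>X. \<Sum>y\<in>Y. (k x y - p) * v x * u y\<bar> \<le> \<beta> * sqrt (\<Sum>x\<in>X. v x) * sqrt (\<Sum>y\<in>Y. u y)"
    using assms uv unfolding jumbled_def by blast
  ultimately show "\<bar>\<Sum>y\<in>Y. \<Sum>x\<in>X. (k x y - p) * u y * v x\<bar> \<le> \<beta> * sqrt (\<Sum>y\<in>Y. u y) * sqrt (\<Sum>x\<in>X. v x)"
    by (simp add: mult_ac)
qed

lemma DISC_swap:
  assumes "DISC G X Y q p \<epsilon>"
  shows "DISC (\<lambda>y x. G x y) Y X q p \<epsilon>"
  unfolding DISC_def
proof (intro ballI)
  fix u v assume uv: "u \<in> Y \<rightarrow> {0..1::real}" "v \<in> X \<rightarrow> {0..1::real}"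
  have "(\<Sum>y\<in>Y. \<Sum>x\<in>X. (G x y - q) * u y * v x) = (\<Sum>x\<in>X. \<Sum>y\<in>Y. (G x y - q) * v x * u y)"
    by (subst sum.swap) (simp add: mult_ac)
  moreover have "\<bar>1 / (real (card X) * real (card Y)) * (\<Sum>x\<in>X. \<Sum>y\<in>Y. (G x y - q) * v x * u y)\<bar> \<le> \<epsilon> * p"
    using assms uv unfolding DISC_def by blast
  ultimately show "\<bar>1 / (real (card Y) * real (card X)) * (\<Sum>y\<in>Y. \<Sum>x\<in>X. (G x y - q) * u y * v x)\<bar> \<le> \<epsilon> * p"
    by (simp add: mult_ac)
qed

lemma DISC_mono: "DISC G X Y q p \<epsilon> \<Longrightarrow> \<epsilon> * p \<le> \<epsilon>' * p \<Longrightarrow> DISC G X Y q p \<epsilon>'"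
  unfolding DISC_def by (meson order_trans)

text \<open>\<open>DISC\<close> is tested against the indicator of the exceptional set on
  \<open>X\<close> and the constant 1 on \<open>Y\<close>; each exceptional vertex contributes a
  deficit of at least \<open>t * p * card Y\<close>.\<close>

lemma card_small_degree_le:
  fixes G :: "'a \<Rightarrow> 'b \<Rightarrow> real" and p q t :: real
  assumes disc: "DISC G X Y q p \<epsilon>" and fin: "finite X" "finite Y" and ne: "X \<noteq> {}" "Y \<noteq> {}"
    and G: "\<And>x y. G x y \<in> {0, 1}" and p: "0 < p" and t: "0 < t"
  shows "card {x \<in> X. real (card {y \<in> Y. G x y = 1}) < (q - t * p) * card Y} \<le> \<epsilon> / t * card X"
    (is "real (card ?B) \<le> _")
proof -
  define u where "u x = (of_bool (x \<in> ?B) :: real)" for x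
  have deg: "(\<Sum>y\<in>Y. G x y) = card {y \<in> Y. G x y = 1}" for x
  proof -
    have "(\<Sum>y\<in>Y. G x y) = (\<Sum>y\<in>Y. of_bool (G x y = 1))"
      using G by (intro sum.cong refl) (metis insertE of_bool_eq(1) of_bool_eq(2) singletonD zero_neq_one)
    moreover have "{y \<in> Y. G x y = 1} = Y \<inter> {y. G x y = 1}" by auto
    ultimately show ?thesis using fin by simp
  qed
  have "(\<Sum>x\<in>X. \<Sum>y\<in>Y. (G x y - q) * u x * 1) = (\<Sum>x\<in>?B. \<Sum>y\<in>Y. G x y - q)"
    using fin by (intro sum.mono_neutral_cong_right) (auto simp: u_def)
  also have "\<dots> \<le> (\<Sum>x\<in>?B. - (t * p * card Y))"
    by (intro sum_mono) (auto simp: sum_subtractf deg algebra_simps)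
  also have "\<dots> = - (card ?B * (t * p * card Y))"
    by simp
  finally have "card ?B * (t * p * card Y) \<le> \<bar>\<Sum>x\<in>X. \<Sum>y\<in>Y. (G x y - q) * u x * 1\<bar>"
    by linarith
  also have "\<dots> \<le> \<epsilon> * p * card X * card Y"
    by (intro DISC_sum_le disc fin ne) (auto simp: u_def)
  finally have "(card ?B * t) * (p * card Y) \<le> (\<epsilon> * card X) * (p * card Y)"
    by (simp add: mult_ac)
  moreover have "0 < p * card Y"
    using p ne fin by (simp add: card_gt_0_iff)
  ultimately have "card ?B * t \<le> \<epsilon> * card X"
    by (rule mult_right_le_imp_le)
  then show ?thesis using t by (simp add: field_simps)
qed

text \<open>\<open>pending E vs j k\<close> counts how often \<open>X j\<close> or \<open>X k\<close> still shrinks by a factor of about \<open>p\<close>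
  before \<open>j\<close> or \<open>k\<close> is embedded, when the vertices are embedded in the order \<open>vs\<close>.\<close>

fun pending :: "('i \<Rightarrow> 'i \<Rightarrow> bool) \<Rightarrow> 'i list \<Rightarrow> 'i \<Rightarrow> 'i \<Rightarrow> nat" where
  "pending E [] j k = 0"
| "pending E (i # vs) j k =
    (if i = j \<or> i = k then 0 else of_bool (E i j) + of_bool (E i k) + pending E vs j k)"

definition candidates ::
    "('i \<Rightarrow> 'i \<Rightarrow> bool) \<Rightarrow> ('a \<Rightarrow> 'a \<Rightarrow> real) \<Rightarrow> 'i \<Rightarrow> 'a \<Rightarrow> ('i \<Rightarrow> 'a set) \<Rightarrow> 'i \<Rightarrow> 'a set" where
  "candidates E G i x V j = (if E i j then {y \<in> V j. G x y = 1} else V j)"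

text \<open>The number of homomorphisms, organised by embedding order: an edge constraint is imposed
  when its earlier endpoint is embedded, by shrinking the candidate set of the later one.\<close>

fun hom_count :: "('i \<Rightarrow> 'i \<Rightarrow> bool) \<Rightarrow> ('a \<Rightarrow> 'a \<Rightarrow> real) \<Rightarrow> 'i list \<Rightarrow> ('i \<Rightarrow> 'a set) \<Rightarrow> real" where
  "hom_count E G [] V = 1"
| "hom_count E G (i # vs) V = (\<Sum>x\<in>V i. hom_count E G vs (candidates E G i x V))"

text \<open>For a distinct list and a symmetric irreflexive \<open>E\<close>, each edge is counted
  once, at the endpoint that comes first in the list.\<close>

fun edge_prod :: "('i \<Rightarrow> 'i \<Rightarrow> bool) \<Rightarrow> ('i \<Rightarrow> 'i \<Rightarrow> real) \<Rightarrow> 'i list \<Rightarrow> real" where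
  "edge_prod E w [] = 1"
| "edge_prod E w (i # vs) = (\<Prod>j\<in>{j \<in> set vs. E i j}. w i j) * edge_prod E w vs"

lemma hom_count_nonneg: "0 \<le> hom_count E G vs V"
  by (induction vs arbitrary: V) (auto intro: sum_nonneg)

lemma edge_prod_nonneg:
  assumes "\<And>i j. i \<in> set vs \<Longrightarrow> j \<in> set vs \<Longrightarrow> E i j \<Longrightarrow> 0 \<le> w i j"
  shows "0 \<le> edge_prod E w vs"
  using assms by (induction vs) (auto intro!: mult_nonneg_nonneg prod_nonneg)

text \<open>The invariant of the embedding. The power of \<open>p\<close> under the root anticipates
  the coming shrinkage: whenever \<open>V j\<close> or \<open>V k\<close> shrinks by a factor of
  about \<open>p\<close>, the exponent drops by one, so the bound is preserved up to a constant
  factor.\<close>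

definition regular_system ::
    "('i \<Rightarrow> 'i \<Rightarrow> bool) \<Rightarrow> ('a \<Rightarrow> 'a \<Rightarrow> real) \<Rightarrow> ('a \<Rightarrow> 'a \<Rightarrow> real) \<Rightarrow> ('i \<Rightarrow> 'i \<Rightarrow> real) \<Rightarrow>
      real \<Rightarrow> real \<Rightarrow> real \<Rightarrow> real \<Rightarrow> 'i list \<Rightarrow> ('i \<Rightarrow> 'a set) \<Rightarrow> bool" where
  "regular_system E \<Gamma> G q \<alpha> p c \<epsilon> vs V \<longleftrightarrow>
    (\<forall>j\<in>set vs. finite (V j) \<and> V j \<noteq> {}) \<and>
    (\<forall>j\<in>set vs. \<forall>k\<in>set vs. E j k \<longrightarrow>
      jumbled \<Gamma> (V j) (V k) p
        (c * p ^ 3 * sqrt (p ^ pending E vs j k * (real (card (V j)) * card (V k)))) \<and>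
      DISC G (V j) (V k) (q j k) p \<epsilon> \<and> \<alpha> * p \<le> q j k \<and> q j k \<le> p)"

locale counting =
  fixes E :: "'i \<Rightarrow> 'i \<Rightarrow> bool" and \<Gamma> G :: "'a \<Rightarrow> 'a \<Rightarrow> real" and q :: "'i \<Rightarrow> 'i \<Rightarrow> real" and \<alpha> p :: real
  assumes E_sym: "E i j \<Longrightarrow> E j i"
    and \<Gamma>01: "\<Gamma> x y \<in> {0, 1}" and G01: "G x y \<in> {0, 1}" and G_le: "G x y \<le> \<Gamma> x y"
    and G_sym: "G x y = G y x" and q_sym: "q i j = q j i"
    and \<alpha>: "0 < \<alpha>" "\<alpha> \<le> 1" and p: "0 < p" "p \<le> 1"
begin

lemma candidates_subset: "candidates E G i x V j \<subseteq> V j"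
  by (auto simp: candidates_def)

text \<open>By \<open>jumbled_mono\<close> the absolute jumbledness is kept, so only the sizes have
  to be compared. Each of the two sets may be smaller by a factor \<open>\<alpha> / 2\<close> than
  \<open>pending\<close> accounts for; under the square root this costs a single factor
  \<open>2 / \<alpha>\<close> in \<open>c\<close>.\<close>

lemma regular_system_candidates:
  assumes reg: "regular_system E \<Gamma> G q \<alpha> p c \<epsilon> (i # vs) V" and dist: "distinct (i # vs)"
    and deg: "\<And>j. j \<in> set vs \<Longrightarrow> E i j \<Longrightarrow> \<alpha> / 2 * p * card (V j) \<le> card (candidates E G i x V j)"
    and disc: "\<And>j k. j \<in> set vs \<Longrightarrow> k \<in> set vs \<Longrightarrow> E j k \<Longrightarrow>
      DISC G (candidates E G i x V j) (candidates E G i x V k) (q j k) p \<epsilon>'"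
    and c: "0 \<le> c" "c * (2 / \<alpha>) \<le> c'"
  shows "regular_system E \<Gamma> G q \<alpha> p c' \<epsilon>' vs (candidates E G i x V)"
proof -
  let ?V = "candidates E G i x V"
  have fin: "finite (V j)" "V j \<noteq> {}" if "j \<in> set vs" for j
    using reg that by (auto simp: regular_system_def)
  have size: "\<alpha> / 2 * (p ^ of_bool (E i j) * card (V j)) \<le> card (?V j)" if "j \<in> set vs" for j
  proof (cases "E i j")
    case True
    then show ?thesis using deg[OF that] by simp
  next
    case False
    have "\<alpha> / 2 * real (card (V j)) \<le> 1 * real (card (V j))"
      using \<alpha> by (intro mult_right_mono) auto
    with False show ?thesis by (simp add: candidates_def)
  qed
  have ne: "?V j \<noteq> {}" if "j \<in> set vs" for j
  proof -
    have "0 < \<alpha> / 2 * (p ^ of_bool (E i j) * card (V j))"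
      using \<alpha> p fin[OF that] by (simp add: card_gt_0_iff)
    with size[OF that] show ?thesis by auto
  qed
  have jum: "jumbled \<Gamma> (?V j) (?V k) p
      (c' * p ^ 3 * sqrt (p ^ pending E vs j k * (real (card (?V j)) * card (?V k))))"
    if jk: "j \<in> set vs" "k \<in> set vs" "E j k" for j k
  proof (rule jumbled_mono[OF _ candidates_subset candidates_subset])
    show "jumbled \<Gamma> (V j) (V k) p
        (c * p ^ 3 * sqrt (p ^ pending E (i # vs) j k * (real (card (V j)) * card (V k))))"
      using reg jk by (auto simp: regular_system_def)
    define A where "A = p ^ of_bool (E i j) * card (V j)"
    define B where "B = p ^ of_bool (E i k) * card (V k)"
    have AB: "0 \<le> A" "0 \<le> B" using p by (auto simp: A_def B_def)
    have "i \<noteq> j" "i \<noteq> k" using dist jk by auto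
    \<comment> \<open>The powers of \<open>p\<close> released by \<open>i\<close> are absorbed into
      \<open>A\<close> and \<open>B\<close>, the expected orders of magnitude of the new candidate
      sets.\<close>
    then have "p ^ pending E (i # vs) j k * (real (card (V j)) * card (V k)) = p ^ pending E vs j k * (A * B)"
      by (simp add: A_def B_def power_add mult_ac)
    also have "A * B \<le> (2 / \<alpha> * card (?V j)) * (2 / \<alpha> * card (?V k))"
    proof (rule mult_mono)
      show "A \<le> 2 / \<alpha> * card (?V j)" "B \<le> 2 / \<alpha> * card (?V k)"
        using size[OF jk(1)] size[OF jk(2)] \<alpha> by (auto simp: A_def B_def field_simps)
    qed (use AB \<alpha> in auto)
    finally have "p ^ pending E (i # vs) j k * (real (card (V j)) * card (V k)) \<le>
        (2 / \<alpha>)\<^sup>2 * (p ^ pending E vs j k * (real (card (?V j)) * card (?V k)))"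
      using p by (simp add: mult_left_mono power2_eq_square mult_ac)
    then have "sqrt (p ^ pending E (i # vs) j k * (real (card (V j)) * card (V k))) \<le>
        sqrt ((2 / \<alpha>)\<^sup>2 * (p ^ pending E vs j k * (real (card (?V j)) * card (?V k))))"
      by (rule real_sqrt_le_mono)
    also have "\<dots> = 2 / \<alpha> * sqrt (p ^ pending E vs j k * (real (card (?V j)) * card (?V k)))"
      using \<alpha> by (subst real_sqrt_mult) simp
    finally have "c * p ^ 3 * sqrt (p ^ pending E (i # vs) j k * (real (card (V j)) * card (V k))) \<le>
        c * p ^ 3 * (2 / \<alpha> * sqrt (p ^ pending E vs j k * (real (card (?V j)) * card (?V k))))"
      using c p by (intro mult_left_mono) auto
    also have "\<dots> = (c * (2 / \<alpha>)) * (p ^ 3 * sqrt (p ^ pending E vs j k * (real (card (?V j)) * card (?V k))))"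
      by (simp only: mult_ac)
    also have "\<dots> \<le> c' * (p ^ 3 * sqrt (p ^ pending E vs j k * (real (card (?V j)) * card (?V k))))"
      using p by (intro mult_right_mono c) auto
    finally show "c * p ^ 3 * sqrt (p ^ pending E (i # vs) j k * (real (card (V j)) * card (V k)))
        \<le> c' * p ^ 3 * sqrt (p ^ pending E vs j k * (real (card (?V j)) * card (?V k)))"
      by (simp only: mult.assoc)
  qed (use fin jk in auto)
  show ?thesis
    unfolding regular_system_def
    using ne jum disc reg finite_subset[OF candidates_subset fin(1)]
    by (auto simp: regular_system_def)
qed

text \<open>Four cases, by which of \<open>j\<close> and \<open>k\<close> are adjacent to
  \<open>i\<close>. If both are, \<open>card_not_inheriting_le\<close> applies with \<open>W\<close>
  equal to \<Gamma>; if one is, with \<open>W\<close> constantly 1; if none is, the candidate sets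
  do not change. The two cases with one neighbour are exchanged by the symmetry of \<open>G\<close>
  and \<open>q\<close>.\<close>

lemma card_irregular_candidates_le:
  assumes reg: "regular_system E \<Gamma> G q \<alpha> p c \<epsilon> (i # vs) V" and dist: "distinct (i # vs)"
    and jk: "j \<in> set vs" "k \<in> set vs" "E j k"
    and c: "0 \<le> c" "c \<le> \<delta> ^ 4 / 5000" and \<epsilon>: "0 \<le> \<epsilon>" "\<epsilon> \<le> \<delta> ^ 4 / 5000" "\<epsilon> \<le> \<epsilon>'"
    and \<delta>: "0 < \<delta>" "\<delta> \<le> 1" and s: "0 < s" "s \<le> 1" and \<epsilon>': "0 < \<epsilon>'"
  shows "card {x \<in> V i. (\<forall>l\<in>{j, k}. E i l \<longrightarrow> s * p * card (V l) \<le> card (candidates E G i x V l)) \<and>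
      \<not> DISC G (candidates E G i x V j) (candidates E G i x V k) (q j k) p \<epsilon>'}
    \<le> \<delta> / (s\<^sup>2 * \<epsilon>') * card (V i)"
proof -
  have fin: "finite (V l)" "V l \<noteq> {}" if "l \<in> insert i (set vs)" for l
    using reg that by (auto simp: regular_system_def)
  have jum: "jumbled \<Gamma> (V l) (V l') p (c * p ^ 3 * sqrt (real (card (V l)) * card (V l')))"
    if "l \<in> insert i (set vs)" "l' \<in> insert i (set vs)" "E l l'" for l l'
  proof (rule jumbled_mono[OF _ order_refl order_refl])
    show "jumbled \<Gamma> (V l) (V l') p
        (c * p ^ 3 * sqrt (p ^ pending E (i # vs) l l' * (real (card (V l)) * card (V l'))))"
      using reg that by (auto simp: regular_system_def simp del: pending.simps)
    \<comment> \<open>The reserve for later shrinkage is given up here; inheritance for the current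
      vertex takes only the factor \<open>p ^ 3\<close>.\<close>
    show "c * p ^ 3 * sqrt (p ^ pending E (i # vs) l l' * (real (card (V l)) * card (V l')))
        \<le> c * p ^ 3 * sqrt (real (card (V l)) * card (V l'))"
      using c p
      by (intro mult_left_mono real_sqrt_le_mono mult_left_le_one_le power_le_one) auto
  qed (use fin that in auto)
  have disc: "DISC G (V l) (V l') (q l l') p \<epsilon>" and q: "0 \<le> q l l'" "q l l' \<le> p"
    if "l \<in> set vs" "l' \<in> set vs" "E l l'" for l l'
  proof -
    have "DISC G (V l) (V l') (q l l') p \<epsilon> \<and> \<alpha> * p \<le> q l l' \<and> q l l' \<le> p"
      using reg that by (auto simp: regular_system_def)
    moreover have "0 \<le> \<alpha> * p" using \<alpha> p by simp
    ultimately show "DISC G (V l) (V l') (q l l') p \<epsilon>" "0 \<le> q l l'" "q l l' \<le> p" by auto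
  qed
  have unit: "0 \<le> \<Gamma> x y \<and> \<Gamma> x y \<le> 1" "0 \<le> G x y \<and> G x y \<le> \<Gamma> x y" for x y
    using \<Gamma>01[of x y] G01[of x y] G_le[of x y] by auto
  have sub: "{y \<in> V l. G x y = 1} \<subseteq> {y \<in> V l. \<Gamma> x y = 1}" for x l
  proof
    fix y assume "y \<in> {y \<in> V l. G x y = 1}"
    then show "y \<in> {y \<in> V l. \<Gamma> x y = 1}"
      using unit[of x y] by auto
  qed
  have one_sided: "card {x \<in> V i. s * p * card (V l) \<le> card (candidates E G i x V l) \<and>
      \<not> DISC G (candidates E G i x V l) (V l') (q l l') p \<epsilon>'} \<le> \<delta> / (s\<^sup>2 * \<epsilon>') * card (V i)"
    (is "real (card ?B) \<le> _")
    if l: "l \<in> set vs" "l' \<in> set vs" "E l l'" "E i l" for l l'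
  proof -
    let ?C = "{z \<in> V i. \<exists>X' Y'. X' \<subseteq> {x \<in> V l. \<Gamma> z x = 1} \<and> Y' \<subseteq> {y \<in> V l'. (1::real) = 1} \<and>
      s * p * card (V l) \<le> card X' \<and> s * 1 * card (V l') \<le> card Y' \<and> \<not> DISC G X' Y' (q l l') p \<epsilon>'}"
    have "?B \<subseteq> ?C"
    proof
      fix x assume "x \<in> ?B"
      then have x: "x \<in> V i" "s * p * card (V l) \<le> card {y \<in> V l. G x y = 1}"
        "\<not> DISC G {y \<in> V l. G x y = 1} (V l') (q l l') p \<epsilon>'"
        using l by (auto simp: candidates_def)
      have "s * 1 * card (V l') \<le> card (V l')" "V l' \<subseteq> {y \<in> V l'. (1::real) = 1}"
        using s by (simp_all add: mult_left_le_one_le)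
      note x = x this
      show "x \<in> ?C"
        by (intro CollectI conjI exI[of _ "{y \<in> V l. G x y = 1}"] exI[of _ "V l'"]) (fact x sub)+
    qed
    then have "real (card ?B) \<le> real (card ?C)"
      using fin by (intro of_nat_mono card_mono) auto
    also have "\<dots> \<le> \<delta> / (s\<^sup>2 * \<epsilon>') * card (V i)"
    proof (rule card_not_inheriting_le[where S = \<Gamma> and c = c and \<epsilon> = \<epsilon>])
      \<comment> \<open>The constant kernel deviates from its density by 0.\<close>
      show "jumbled (\<lambda>z y. 1) (V i) (V l') 1 (c * p ^ 3 * sqrt (real (card (V i)) * card (V l')))"
        unfolding jumbled_def using c p
        by (auto intro!: mult_nonneg_nonneg real_sqrt_ge_zero sum_nonneg)
    qed (use fin l jum disc q unit p c \<epsilon> \<delta> s \<epsilon>' in \<open>simp_all\<close>)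
    finally show ?thesis .
  qed
  consider (both) "E i j" "E i k" | (left) "E i j" "\<not> E i k" | (right) "\<not> E i j" "E i k"
    | (none) "\<not> E i j" "\<not> E i k" by blast
  then show ?thesis
  proof cases
    case both
    let ?C = "{z \<in> V i. \<exists>X' Y'. X' \<subseteq> {x \<in> V j. \<Gamma> z x = 1} \<and> Y' \<subseteq> {y \<in> V k. \<Gamma> z y = 1} \<and>
      s * p * card (V j) \<le> card X' \<and> s * p * card (V k) \<le> card Y' \<and> \<not> DISC G X' Y' (q j k) p \<epsilon>'}"
    have "card ?C \<le> \<delta> / (s\<^sup>2 * \<epsilon>') * card (V i)"
      by (rule card_not_inheriting_le[where S = \<Gamma> and c = c and \<epsilon> = \<epsilon>])
        (use both fin jk jum disc q unit p c \<epsilon> \<delta> s \<epsilon>' in simp_all)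
    moreover have "{x \<in> V i. (\<forall>l\<in>{j, k}. E i l \<longrightarrow> s * p * card (V l) \<le> card (candidates E G i x V l)) \<and>
        \<not> DISC G (candidates E G i x V j) (candidates E G i x V k) (q j k) p \<epsilon>'} \<subseteq> ?C" (is "?B \<subseteq> _")
    proof
      fix x assume "x \<in> ?B"
      then have x: "x \<in> V i" "s * p * card (V j) \<le> card {y \<in> V j. G x y = 1}"
        "s * p * card (V k) \<le> card {y \<in> V k. G x y = 1}"
        "\<not> DISC G {y \<in> V j. G x y = 1} {y \<in> V k. G x y = 1} (q j k) p \<epsilon>'"
        using both by (auto simp: candidates_def)
      show "x \<in> ?C"
        by (intro CollectI conjI exI[of _ "{y \<in> V j. G x y = 1}"] exI[of _ "{y \<in> V k. G x y = 1}"])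
          (fact x sub)+
    qed
    then have "real (card ?B) \<le> real (card ?C)"
      using fin by (intro of_nat_mono card_mono) auto
    ultimately show ?thesis by linarith
  next
    case left
    then have "candidates E G i x V k = V k" for x
      by (simp add: candidates_def)
    with one_sided[OF jk left(1)] left show ?thesis by simp
  next
    case right
    then have "candidates E G i x V j = V j" for x
      by (simp add: candidates_def)
    moreover have "DISC G X Y (q k j) p \<epsilon>' \<longleftrightarrow> DISC G Y X (q j k) p \<epsilon>'" for X Y
    proof -
      have "(\<lambda>y x. G x y) = G" using G_sym by (intro ext) auto
      then show ?thesis using DISC_swap[of G X Y] DISC_swap[of G Y X] q_sym[of j k] by metis
    qed
    ultimately show ?thesis
      using one_sided[OF jk(2,1) E_sym[OF jk(3)] right(2)] right by simp
  next
    case none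
    have "DISC G (V j) (V k) (q j k) p \<epsilon>'"
      using disc[OF jk] \<epsilon> p by (elim DISC_mono) (simp add: mult_right_mono)
    with none \<delta> s \<epsilon>' show ?thesis by (simp add: candidates_def)
  qed
qed

text \<open>An image of \<open>i\<close> is bad if some neighbour keeps too few candidates or some
  pair loses its regularity. With \<open>N = length vs\<close>, there are at most
  \<open>N + N * N\<close> such events, each of proportion at most \<mu>, so at most a proportion
  \<kappa> is bad. The loss \<open>(1 - \<kappa>) ^ (N + 2)\<close> collects one factor for the bad
  images, one for the recursive count, and one for each later vertex because of its candidate
  set.\<close>

lemma hom_count_step:
  assumes reg: "regular_system E \<Gamma> G q \<alpha> p c \<epsilon> (i # vs) V" and dist: "distinct (i # vs)"
    and count: "\<And>V'. regular_system E \<Gamma> G q \<alpha> p c' \<epsilon>' vs V' \<Longrightarrow>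
      (1 - \<kappa>) * (edge_prod E q vs * (\<Prod>j\<in>set vs. real (card (V' j)))) \<le> hom_count E G vs V'"
    and \<kappa>: "0 < \<kappa>" "\<kappa> \<le> 1 / 2" and \<mu>: "0 \<le> \<mu>" "\<mu> * (real (length vs) + 1)\<^sup>2 \<le> \<kappa>"
    and \<delta>: "0 < \<delta>" "\<delta> \<le> 1" "\<delta> \<le> \<mu> * ((\<alpha> / 2)\<^sup>2 * \<epsilon>')"
    and c: "0 \<le> c" "c \<le> \<delta> ^ 4 / 5000" "c * (2 / \<alpha>) \<le> c'"
    and \<epsilon>: "0 \<le> \<epsilon>" "\<epsilon> \<le> \<delta> ^ 4 / 5000" "\<epsilon> \<le> \<epsilon>'" "\<epsilon> \<le> \<mu> * (\<kappa> * \<alpha>)" and \<epsilon>': "0 < \<epsilon>'"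
  shows "(1 - \<kappa>) ^ (length vs + 2) * (edge_prod E q (i # vs) * (\<Prod>j\<in>set (i # vs). real (card (V j))))
    \<le> hom_count E G (i # vs) V"
proof -
  let ?n = "real (card (V i))" and ?N = "length vs" and ?s = "\<alpha> / 2"
  let ?V = "\<lambda>x. candidates E G i x V"
  \<comment> \<open>As \<open>\<alpha> * p \<le> q i j\<close>, the allowed deficit
    \<open>\<kappa> * \<alpha> * p\<close> is at most a proportion \<kappa> of the density.\<close>
  define D where "D j = {x \<in> V i. real (card {y \<in> V j. G x y = 1}) < (q i j - \<kappa> * \<alpha> * p) * card (V j)}" for j
  define R where "R jk = (case jk of (j, k) \<Rightarrow>
    {x \<in> V i. (\<forall>l\<in>{j, k}. E i l \<longrightarrow> ?s * p * card (V l) \<le> card (?V x l)) \<and>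
      \<not> DISC G (?V x j) (?V x k) (q j k) p \<epsilon>'})" for jk
  define J where "J = {j \<in> set vs. E i j}"
  define P where "P = {(j, k) \<in> set vs \<times> set vs. E j k}"
  define Bad where "Bad = (\<Union>j\<in>J. D j) \<union> (\<Union>jk\<in>P. R jk)"
  have fin: "finite (V l)" "V l \<noteq> {}" if "l \<in> insert i (set vs)" for l
    using reg that by (auto simp: regular_system_def)
  have edge: "DISC G (V l) (V l') (q l l') p \<epsilon>" "\<alpha> * p \<le> q l l'" "0 \<le> q l l'"
    if "l \<in> insert i (set vs)" "l' \<in> insert i (set vs)" "E l l'" for l l'
  proof -
    show "DISC G (V l) (V l') (q l l') p \<epsilon>" "\<alpha> * p \<le> q l l'"
      using reg that by (auto simp: regular_system_def)
    moreover have "0 \<le> \<alpha> * p" using \<alpha> p by simp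
    ultimately show "0 \<le> q l l'" by linarith
  qed
  have cardN: "card (set vs) = ?N" using dist by (simp add: distinct_card)
  have finJ: "finite J" "card J \<le> ?N"
    unfolding J_def using card_mono[of "set vs" "{j \<in> set vs. E i j}"] cardN by auto
  have "P \<subseteq> set vs \<times> set vs" by (auto simp: P_def)
  then have finP: "finite P" "card P \<le> ?N * ?N"
    using finite_subset[of P] card_mono[of "set vs \<times> set vs" P] cardN
    by (auto simp: card_cartesian_product)
  have D_card: "real (card (D j)) \<le> \<mu> * ?n" if "j \<in> J" for j
  proof -
    have "real (card (D j)) \<le> \<epsilon> / (\<kappa> * \<alpha>) * ?n"
      unfolding D_def using that \<kappa> \<alpha> p G01
      by (intro card_small_degree_le edge fin) (auto simp: J_def)
    also have "\<dots> \<le> \<mu> * ?n"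
      using \<epsilon> \<kappa> \<alpha> by (intro mult_right_mono) (auto simp: divide_le_eq)
    finally show ?thesis .
  qed
  have R_card: "real (card (R jk)) \<le> \<mu> * ?n" if jkP: "jk \<in> P" for jk
  proof -
    obtain j k where jk: "jk = (j, k)" "j \<in> set vs" "k \<in> set vs" "E j k"
      using jkP by (auto simp: P_def)
    have s: "0 < ?s" "?s \<le> 1" using \<alpha> by auto
    have "real (card (R jk)) \<le> \<delta> / (?s\<^sup>2 * \<epsilon>') * ?n"
      unfolding R_def jk(1) prod.case
      by (rule card_irregular_candidates_le[OF reg dist jk(2-4) c(1,2) \<epsilon>(1-3) \<delta>(1,2) s \<epsilon>'])
    also have "\<dots> \<le> \<mu> * ?n"
    proof (intro mult_right_mono)
      have "0 < ?s\<^sup>2 * \<epsilon>'" using s \<epsilon>' by (intro mult_pos_pos zero_less_power)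
      then show "\<delta> / (?s\<^sup>2 * \<epsilon>') \<le> \<mu>" using \<delta>(3) by (subst pos_divide_le_eq)
    qed simp
    finally show ?thesis .
  qed
  have Bad_sub: "Bad \<subseteq> V i"
    by (auto simp: Bad_def D_def R_def)
  have "real (card Bad) \<le> real (\<Sum>j\<in>J. card (D j)) + real (\<Sum>jk\<in>P. card (R jk))"
    unfolding Bad_def of_nat_add[symmetric] of_nat_le_iff
    by (rule order_trans[OF card_Un_le add_mono[OF card_UN_le card_UN_le]]) (use finJ finP in auto)
  also have "\<dots> \<le> card J * (\<mu> * ?n) + card P * (\<mu> * ?n)"
    unfolding of_nat_sum using D_card R_card
    by (intro add_mono sum_bounded_above) auto
  also have "\<dots> \<le> ?N * (\<mu> * ?n) + (?N * ?N) * (\<mu> * ?n)"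
    using finJ finP \<mu> by (intro add_mono mult_right_mono) (auto simp flip: of_nat_mult)
  also have "\<dots> \<le> (real ?N + 1)\<^sup>2 * (\<mu> * ?n)"
    unfolding distrib_right[symmetric] using \<mu>
    by (intro mult_right_mono) (auto simp: power2_eq_square algebra_simps)
  also have "\<dots> = \<mu> * (real ?N + 1)\<^sup>2 * ?n"
    by simp
  also have "\<dots> \<le> \<kappa> * ?n"
    by (intro mult_right_mono \<mu>) simp
  finally have Bad_card: "real (card Bad) \<le> \<kappa> * ?n" .
  have Good_card: "(1 - \<kappa>) * ?n \<le> card (V i - Bad)"
  proof -
    have "card (V i - Bad) = card (V i) - card Bad"
      using Bad_sub fin(1)[of i] finite_subset by (intro card_Diff_subset) auto
    moreover have "card Bad \<le> card (V i)"
      using Bad_sub fin(1)[of i] by (intro card_mono) auto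
    ultimately show ?thesis using Bad_card by (simp add: of_nat_diff algebra_simps)
  qed
  define w where "w j = (if E i j then q i j else 1)" for j
  have w0: "0 \<le> w j" if "j \<in> set vs" for j
    using edge[of i j] that by (auto simp: w_def)
  have ep0: "0 \<le> edge_prod E q vs"
    by (rule edge_prod_nonneg) (use edge(3) in auto)
  define L where "L = (1 - \<kappa>) * (edge_prod E q vs * (\<Prod>j\<in>set vs. (1 - \<kappa>) * (w j * card (V j))))"
  have good: "L \<le> hom_count E G vs (?V x)" if x: "x \<in> V i - Bad" for x
  proof -
    have deg: "(1 - \<kappa>) * (q i j * card (V j)) \<le> card (?V x j)"
        "?s * p * card (V j) \<le> card (?V x j)" if j: "j \<in> set vs" "E i j" for j
    proof -
      have "x \<notin> D j" using x j by (auto simp: Bad_def J_def)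
      then have 1: "(q i j - \<kappa> * \<alpha> * p) * card (V j) \<le> card (?V x j)"
        using x j by (simp add: D_def candidates_def not_less)
      have q: "\<alpha> * p \<le> q i j" using edge j by auto
      have "\<kappa> * (\<alpha> * p) \<le> \<kappa> * q i j" using q \<kappa> by (intro mult_left_mono) auto
      then have 2: "(1 - \<kappa>) * q i j \<le> q i j - \<kappa> * \<alpha> * p" by (simp add: algebra_simps)
      \<comment> \<open>By \<open>\<kappa> \<le> 1 / 2\<close>; this is why the size threshold is
        \<open>\<alpha> / 2\<close>.\<close>
      have 3: "?s * p \<le> (1 - \<kappa>) * q i j"
      proof -
        have "1 / 2 * (\<alpha> * p) \<le> (1 - \<kappa>) * q i j"
          using q \<kappa> \<alpha> p by (intro mult_mono) auto
        then show ?thesis by simp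
      qed
      have "(1 - \<kappa>) * q i j * card (V j) \<le> (q i j - \<kappa> * \<alpha> * p) * card (V j)"
        by (intro mult_right_mono 2) simp
      with 1 show a: "(1 - \<kappa>) * (q i j * card (V j)) \<le> card (?V x j)" by (simp add: mult.assoc)
      have "?s * p * card (V j) \<le> (1 - \<kappa>) * q i j * card (V j)"
        by (intro mult_right_mono 3) simp
      with a show "?s * p * card (V j) \<le> card (?V x j)" by (simp add: mult.assoc)
    qed
    have "DISC G (?V x j) (?V x k) (q j k) p \<epsilon>'" if "j \<in> set vs" "k \<in> set vs" "E j k" for j k
    proof -
      have "x \<notin> R (j, k)" using x that by (auto simp: Bad_def P_def)
      then show ?thesis using x deg(2) that by (auto simp: R_def)
    qed
    with deg(2) have "regular_system E \<Gamma> G q \<alpha> p c' \<epsilon>' vs (?V x)"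
      by (intro regular_system_candidates[OF reg dist] c) auto
    then have "(1 - \<kappa>) * (edge_prod E q vs * (\<Prod>j\<in>set vs. real (card (?V x j)))) \<le> hom_count E G vs (?V x)"
      by (rule count)
    moreover have "(\<Prod>j\<in>set vs. (1 - \<kappa>) * (w j * card (V j))) \<le> (\<Prod>j\<in>set vs. real (card (?V x j)))"
    proof (intro prod_mono conjI)
      fix j assume j: "j \<in> set vs"
      show "0 \<le> (1 - \<kappa>) * (w j * card (V j))"
        using w0[OF j] \<kappa> by simp
      show "(1 - \<kappa>) * (w j * card (V j)) \<le> card (?V x j)"
      proof (cases "E i j")
        case True
        then show ?thesis using deg(1)[OF j] by (simp add: w_def)
      next
        case False
        have "(1 - \<kappa>) * real (card (V j)) \<le> 1 * real (card (V j))"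
          using \<kappa> by (intro mult_right_mono) auto
        with False show ?thesis by (simp add: w_def candidates_def)
      qed
    qed
    then have "L \<le> (1 - \<kappa>) * (edge_prod E q vs * (\<Prod>j\<in>set vs. real (card (?V x j))))"
      unfolding L_def using \<kappa> ep0 by (intro mult_left_mono) auto
    ultimately show ?thesis by linarith
  qed
  have L0: "0 \<le> L"
    unfolding L_def using \<kappa> ep0 w0 by (intro mult_nonneg_nonneg prod_nonneg) auto
  have "(\<Prod>j\<in>set vs. (1 - \<kappa>) * (w j * card (V j))) =
      (1 - \<kappa>) ^ ?N * ((\<Prod>j\<in>J. q i j) * (\<Prod>j\<in>set vs. real (card (V j))))"
  proof -
    have "(\<Prod>j\<in>set vs. w j) = (\<Prod>j\<in>J. q i j)"
      by (rule prod.mono_neutral_cong_right) (auto simp: w_def J_def)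
    then show ?thesis by (simp add: prod.distrib cardN)
  qed
  then have "(1 - \<kappa>) ^ (?N + 2) * (edge_prod E q (i # vs) * (\<Prod>j\<in>set (i # vs). real (card (V j)))) =
      (1 - \<kappa>) * ?n * L"
    using dist by (simp add: L_def J_def)
  also have "\<dots> \<le> card (V i - Bad) * L"
    by (intro mult_right_mono Good_card L0)
  also have "\<dots> = (\<Sum>x\<in>V i - Bad. L)"
    by simp
  also have "\<dots> \<le> (\<Sum>x\<in>V i - Bad. hom_count E G vs (?V x))"
    by (intro sum_mono good)
  \<comment> \<open>Bad images are simply discarded, so the argument gives a lower bound
    only.\<close>
  also have "\<dots> \<le> (\<Sum>x\<in>V i. hom_count E G vs (?V x))"
    using fin(1)[of i] by (intro sum_mono2) (auto intro: hom_count_nonneg)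
  finally show ?thesis by simp
qed

end

text \<open>Induction on the embedding order, with \<theta> generalised because the shorter list is
  counted to the finer precision \<kappa>. The constants are fixed before \<open>p\<close> and the
  graphs, starting from the last embedded vertex.\<close>

lemma counting_lemma:
  fixes E :: "'i \<Rightarrow> 'i \<Rightarrow> bool"
  assumes \<alpha>: "0 < \<alpha>" and dist: "distinct vs" and \<theta>: "0 < \<theta>" "\<theta> \<le> 1"
  shows "\<exists>c>0. \<exists>\<epsilon>>0. \<forall>p \<Gamma> (G :: 'a \<Rightarrow> 'a \<Rightarrow> real) q V. counting E \<Gamma> G q \<alpha> p \<longrightarrow>
    regular_system E \<Gamma> G q \<alpha> p c \<epsilon> vs V \<longrightarrow>
    (1 - \<theta>) * (edge_prod E q vs * (\<Prod>j\<in>set vs. real (card (V j)))) \<le> hom_count E G vs V"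
  using dist \<theta>
proof (induction vs arbitrary: \<theta>)
  case Nil
  then show ?case by (auto intro!: exI[of _ 1])
next
  case (Cons i vs)
  define N where "N = real (length vs)"
  \<comment> \<open>Chosen so that Bernoulli's inequality turns the \<open>N + 2\<close> factors
    \<open>1 - \<kappa>\<close> of a step into \<open>1 - \<theta>\<close>.\<close>
  define \<kappa> where "\<kappa> = \<theta> / (N + 2)"
  have N: "0 \<le> N" by (simp add: N_def)
  have \<kappa>: "0 < \<kappa>" "\<kappa> \<le> 1 / 2"
    using Cons.prems N by (auto simp: \<kappa>_def field_simps)
  then have "\<kappa> \<le> 1" by simp
  with Cons.IH[of \<kappa>] Cons.prems \<kappa> obtain c' \<epsilon>' where c': "0 < c'" and \<epsilon>': "0 < \<epsilon>'"
    and IH: "\<And>p \<Gamma> (G :: 'a \<Rightarrow> 'a \<Rightarrow> real) q V. counting E \<Gamma> G q \<alpha> p \<Longrightarrow>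
      regular_system E \<Gamma> G q \<alpha> p c' \<epsilon>' vs V \<Longrightarrow>
      (1 - \<kappa>) * (edge_prod E q vs * (\<Prod>j\<in>set vs. real (card (V j)))) \<le> hom_count E G vs V"
    by auto
  define \<mu> where "\<mu> = \<kappa> / (N + 1)\<^sup>2"
  have \<mu>: "0 < \<mu>" "\<mu> * (real (length vs) + 1)\<^sup>2 \<le> \<kappa>"
    using \<kappa> N by (auto simp: \<mu>_def N_def)
  define \<delta> where "\<delta> = min 1 (\<mu> * ((\<alpha> / 2)\<^sup>2 * \<epsilon>'))"
  have \<delta>: "0 < \<delta>" "\<delta> \<le> 1" "\<delta> \<le> \<mu> * ((\<alpha> / 2)\<^sup>2 * \<epsilon>')"
    using \<mu> \<alpha> \<epsilon>' by (auto simp: \<delta>_def)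
  define c where "c = min (\<delta> ^ 4 / 5000) (c' * (\<alpha> / 2))"
  define \<epsilon> where "\<epsilon> = min (\<delta> ^ 4 / 5000) (min \<epsilon>' (\<mu> * (\<kappa> * \<alpha>)))"
  have c: "0 < c" "c \<le> \<delta> ^ 4 / 5000" "c \<le> c' * (\<alpha> / 2)"
    using \<delta> c' \<alpha> by (auto simp: c_def)
  then have c3: "c * (2 / \<alpha>) \<le> c'"
    using \<alpha> by (simp add: field_simps)
  have \<epsilon>: "0 < \<epsilon>" "\<epsilon> \<le> \<delta> ^ 4 / 5000" "\<epsilon> \<le> \<epsilon>'" "\<epsilon> \<le> \<mu> * (\<kappa> * \<alpha>)"
    using \<delta> \<epsilon>' \<mu> \<kappa> \<alpha> by (auto simp: \<epsilon>_def)
  have Bernoulli: "1 - \<theta> \<le> (1 - \<kappa>) ^ (length vs + 2)"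
  proof -
    have "1 + real (length vs + 2) * (- \<kappa>) \<le> (1 + (- \<kappa>)) ^ (length vs + 2)"
      using \<kappa> by (intro Bernoulli_inequality) auto
    moreover have "real (length vs + 2) * \<kappa> = \<theta>"
      by (simp add: \<kappa>_def N_def field_simps)
    ultimately show ?thesis by simp
  qed
  have "(1 - \<theta>) * (edge_prod E q (i # vs) * (\<Prod>j\<in>set (i # vs). real (card (V j)))) \<le> hom_count E G (i # vs) V"
    if cnt: "counting E \<Gamma> G q \<alpha> p" and reg: "regular_system E \<Gamma> G q \<alpha> p c \<epsilon> (i # vs) V"
    for p \<Gamma> and G :: "'a \<Rightarrow> 'a \<Rightarrow> real" and q V
  proof -
    interpret counting E \<Gamma> G q \<alpha> p by (rule cnt)
    have q: "0 \<le> q j k" if "j \<in> set (i # vs)" "k \<in> set (i # vs)" "E j k" for j k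
    proof -
      have "\<alpha> * p \<le> q j k" using reg that by (auto simp: regular_system_def)
      moreover have "0 \<le> \<alpha> * p" using \<alpha> p by simp
      ultimately show ?thesis by linarith
    qed
    have "0 \<le> edge_prod E q (i # vs)"
      by (rule edge_prod_nonneg) (use q in blast)
    then have "(1 - \<theta>) * (edge_prod E q (i # vs) * (\<Prod>j\<in>set (i # vs). real (card (V j)))) \<le>
        (1 - \<kappa>) ^ (length vs + 2) * (edge_prod E q (i # vs) * (\<Prod>j\<in>set (i # vs). real (card (V j))))"
      by (intro mult_right_mono Bernoulli mult_nonneg_nonneg prod_nonneg) auto
    also have "\<dots> \<le> hom_count E G (i # vs) V"
      using \<mu> c \<epsilon>
      by (intro hom_count_step[OF reg Cons.prems(1) IH[OF cnt] \<kappa> _ \<mu>(2) \<delta> _ c(2) c3 _ \<epsilon>(2-4) \<epsilon>']) auto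
    finally show ?thesis .
  qed
  with c(1) \<epsilon>(1) show ?case by blast
qed

section \<open>From the recursive count back to the homomorphism density\<close>

lemma edge_prod_cong:
  assumes "\<And>i j. i \<in> set vs \<Longrightarrow> j \<in> set vs \<Longrightarrow> w i j = w' i j"
  shows "edge_prod E w vs = edge_prod E w' vs"
  using assms by (induction vs) (auto intro!: arg_cong2[of _ _ _ _ "(*)"] prod.cong)

text \<open>Embedding order and the order on the vertices are unrelated. The edges from a new vertex
  \<open>i\<close> are sorted by the injection \<open>g\<close>, and the symmetry of
  \<open>w\<close> makes the orientation irrelevant.\<close>

lemma edge_prod_eq_prod_pairs:
  fixes E :: "'i::linorder \<Rightarrow> 'i \<Rightarrow> bool"
  assumes sym: "\<And>i j. E i j \<Longrightarrow> E j i" and irr: "\<And>i. \<not> E i i" and w: "\<And>i j. w i j = w j i"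
    and "distinct vs"
  shows "edge_prod E w vs = (\<Prod>(i, j)\<in>{(i, j). E i j \<and> i < j \<and> i \<in> set vs \<and> j \<in> set vs}. w i j)"
  using \<open>distinct vs\<close>
proof (induction vs)
  case Nil
  then show ?case by simp
next
  case (Cons i vs)
  define A where "A = {(i, j). E i j \<and> i < j \<and> i \<in> set vs \<and> j \<in> set vs}"
  define J where "J = {j \<in> set vs. E i j}"
  define g where "g j = (min i j, max i j)" for j
  have "A \<subseteq> set vs \<times> set vs" by (auto simp: A_def)
  then have finA: "finite A" by (rule finite_subset) simp
  have eq: "{(a, b). E a b \<and> a < b \<and> a \<in> set (i # vs) \<and> b \<in> set (i # vs)} = g ` J \<union> A"
    (is "?L = _")
  proof
    show "?L \<subseteq> g ` J \<union> A"
    proof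
      fix e assume "e \<in> ?L"
      then obtain a b where e: "e = (a, b)" and ab: "E a b" "a < b"
        and mem: "a = i \<or> a \<in> set vs" "b = i \<or> b \<in> set vs"
        by auto
      then consider "a \<in> set vs" "b \<in> set vs" | "a = i" "b \<in> set vs" | "b = i" "a \<in> set vs"
        by auto
      then show "e \<in> g ` J \<union> A"
      proof cases
        case 1
        then show ?thesis using e ab by (simp add: A_def)
      next
        case 2
        then have "b \<in> J" "e = g b" using e ab by (auto simp: J_def g_def)
        then show ?thesis by blast
      next
        case 3
        then have "a \<in> J" "e = g a" using e ab sym by (auto simp: J_def g_def)
        then show ?thesis by blast
      qed
    qed
    have "g j \<in> ?L" if j: "j \<in> J" for j
    proof -
      have "i \<noteq> j" using j irr by (auto simp: J_def)
      then show ?thesis using j sym[of i j] by (cases "i < j") (auto simp: J_def g_def min_def max_def)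
    qed
    then have "g ` J \<subseteq> ?L" by (rule image_subsetI)
    moreover have "A \<subseteq> ?L" by (auto simp: A_def)
    ultimately show "g ` J \<union> A \<subseteq> ?L" by (rule Un_least)
  qed
  have disj: "g ` J \<inter> A = {}"
    using Cons.prems by (auto simp: A_def g_def min_def max_def split: if_splits)
  have inj: "inj_on g J"
    by (auto simp: inj_on_def g_def min_def max_def split: if_splits)
  have "(\<Prod>(a, b)\<in>g ` J. w a b) = (\<Prod>j\<in>J. w i j)"
    unfolding prod.reindex[OF inj] using w by (intro prod.cong) (auto simp: g_def min_def max_def)
  then show ?case
    unfolding eq using finA disj Cons
    by (subst prod.union_disjoint) (auto simp: J_def A_def)
qed

text \<open>As \<open>G\<close> takes only the values 0 and 1, restricting a map to the candidate
  sets amounts to multiplying by the edge factors at \<open>i\<close>: maps outside the candidate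
  sets contribute 0, the others a factor 1.\<close>

lemma hom_count_eq_sum:
  assumes G01: "\<And>x y. G x y \<in> {0, 1}" and "distinct vs" and "\<And>i. i \<in> set vs \<Longrightarrow> finite (V i)"
  shows "hom_count E G vs V = (\<Sum>x\<in>Pi\<^sub>E (set vs) V. edge_prod E (\<lambda>i j. G (x i) (x j)) vs)"
  using assms(2,3)
proof (induction vs arbitrary: V)
  case Nil
  then show ?case by simp
next
  case (Cons i vs)
  have i: "i \<notin> set vs" using Cons.prems by simp
  have fin: "finite (Pi\<^sub>E (set vs) V)"
    using Cons.prems by (intro finite_PiE) auto
  have inj: "inj_on (\<lambda>(y, g). g(i := y)) (V i \<times> Pi\<^sub>E (set vs) V)"
  proof (rule inj_onI, clarify)
    fix y y' g g' assume g: "g \<in> Pi\<^sub>E (set vs) V" "g' \<in> Pi\<^sub>E (set vs) V" and e: "g(i := y) = g'(i := y')"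
    \<comment> \<open>Both functions are extensional on \<open>set vs\<close>, hence
      \<open>undefined\<close> at \<open>i\<close>.\<close>
    have "g i = g' i" using PiE_arb[OF g(1) i] PiE_arb[OF g(2) i] by simp
    then have "g x = g' x" for x
      using fun_cong[OF e, of x] by (cases "x = i") auto
    then show "y = y' \<and> g = g'" using fun_cong[OF e, of i] by auto
  qed
  have step: "hom_count E G vs (candidates E G i y V) =
      (\<Sum>g\<in>Pi\<^sub>E (set vs) V. edge_prod E (\<lambda>a b. G ((g(i := y)) a) ((g(i := y)) b)) (i # vs))"
    if y: "y \<in> V i" for y
  proof -
    have fc: "finite (candidates E G i y V j)" if "j \<in> set vs" for j
      using Cons.prems that by (auto simp: candidates_def)
    have set_eq: "Pi\<^sub>E (set vs) (candidates E G i y V) =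
        {g \<in> Pi\<^sub>E (set vs) V. \<forall>j\<in>{j \<in> set vs. E i j}. G y (g j) = 1}"
      by (auto simp: PiE_iff extensional_def candidates_def split: if_splits)
    have "hom_count E G vs (candidates E G i y V) =
        (\<Sum>g\<in>Pi\<^sub>E (set vs) (candidates E G i y V). edge_prod E (\<lambda>a b. G (g a) (g b)) vs)"
      using Cons.prems fc by (intro Cons.IH) auto
    also have "\<dots> = (\<Sum>g\<in>Pi\<^sub>E (set vs) V.
        (\<Prod>j\<in>{j \<in> set vs. E i j}. G y (g j)) * edge_prod E (\<lambda>a b. G (g a) (g b)) vs)"
    proof (rule sum.mono_neutral_cong_left[OF fin])
      show "\<forall>g\<in>Pi\<^sub>E (set vs) V - Pi\<^sub>E (set vs) (candidates E G i y V).
          (\<Prod>j\<in>{j \<in> set vs. E i j}. G y (g j)) * edge_prod E (\<lambda>a b. G (g a) (g b)) vs = 0"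
      proof
        fix g assume "g \<in> Pi\<^sub>E (set vs) V - Pi\<^sub>E (set vs) (candidates E G i y V)"
        then obtain j where "j \<in> {j \<in> set vs. E i j}" "G y (g j) \<noteq> 1"
          unfolding set_eq by blast
        moreover from this have "G y (g j) = 0" using G01[of y "g j"] by auto
        ultimately have "(\<Prod>j\<in>{j \<in> set vs. E i j}. G y (g j)) = 0"
          by (intro prod_zero) auto
        then show "(\<Prod>j\<in>{j \<in> set vs. E i j}. G y (g j)) * edge_prod E (\<lambda>a b. G (g a) (g b)) vs = 0"
          by simp
      qed
    qed (auto simp: set_eq)
    also have "\<dots> = (\<Sum>g\<in>Pi\<^sub>E (set vs) V. edge_prod E (\<lambda>a b. G ((g(i := y)) a) ((g(i := y)) b)) (i # vs))"
    proof (rule sum.cong[OF refl])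
      fix g
      have "edge_prod E (\<lambda>a b. G (g a) (g b)) vs = edge_prod E (\<lambda>a b. G ((g(i := y)) a) ((g(i := y)) b)) vs"
        using i by (intro edge_prod_cong) auto
      moreover have "(\<Prod>j\<in>{j \<in> set vs. E i j}. G y (g j)) =
          (\<Prod>j\<in>{j \<in> set vs. E i j}. G ((g(i := y)) i) ((g(i := y)) j))"
        using i by (intro prod.cong) auto
      ultimately show "(\<Prod>j\<in>{j \<in> set vs. E i j}. G y (g j)) * edge_prod E (\<lambda>a b. G (g a) (g b)) vs =
          edge_prod E (\<lambda>a b. G ((g(i := y)) a) ((g(i := y)) b)) (i # vs)"
        by (simp only: edge_prod.simps)
    qed
    finally show ?thesis .
  qed
  have "(\<Sum>x\<in>Pi\<^sub>E (set (i # vs)) V. edge_prod E (\<lambda>i j. G (x i) (x j)) (i # vs)) =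
      (\<Sum>(y, g)\<in>V i \<times> Pi\<^sub>E (set vs) V. edge_prod E (\<lambda>a b. G ((g(i := y)) a) ((g(i := y)) b)) (i # vs))"
    unfolding list.set PiE_insert_eq sum.reindex[OF inj] by (intro sum.cong refl) auto
  also have "\<dots> = (\<Sum>y\<in>V i. \<Sum>g\<in>Pi\<^sub>E (set vs) V. edge_prod E (\<lambda>a b. G ((g(i := y)) a) ((g(i := y)) b)) (i # vs))"
    by (rule sum.cartesian_product[symmetric])
  also have "\<dots> = hom_count E G (i # vs) V"
    by (simp only: hom_count.simps) (intro sum.cong refl step[symmetric])
  finally show ?case by (rule sym)
qed

section \<open>Pending neighbours and 2-degeneracy\<close>

lemma pending_commute: "pending E vs j k = pending E vs k j"
  by (induction vs) auto

lemma pending_append: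
  assumes "j \<notin> set us" "k \<notin> set us"
  shows "pending E (us @ j # ws) j k = length (filter (\<lambda>h. E h j) us) + length (filter (\<lambda>h. E h k) us)"
  using assms by (induction us) auto

text \<open>The count stops at \<open>v a\<close>, the earlier of the two vertices, so exactly the
  neighbours in the prefix of length \<open>a - 1\<close> enter. This is the quantity that the
  2-degeneracy bounds by \<open>2 * d\<close>.\<close>

lemma pending_eq_nbrs_upto:
  assumes bij: "bij_betw v {1..m} S" and ab: "a \<in> {1..m}" "b \<in> {1..m}" "a < b"
  shows "pending (\<lambda>i j. (i, j) \<in> parcs H) (map v [1..<Suc m]) (v a) (v b) =
    nbrs_upto H v (a - 1) a + nbrs_upto H v (a - 1) b"
proof -
  have split: "map v [1..<Suc m] = map v [1..<a] @ v a # map v [Suc a..<Suc m]"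
    using ab upt_add_eq_append[of 1 a "Suc m - a"] upt_conv_Cons[of a "Suc m"] by auto
  have notin: "v c \<notin> set (map v [1..<a])" if "c \<in> {1..m}" "a \<le> c" for c
    using that ab bij_betw_imp_inj_on[OF bij] by (auto dest: inj_onD)
  have count: "length (filter (\<lambda>h. (h, v c) \<in> parcs H) (map v [1..<a])) = nbrs_upto H v (a - 1) c" for c
  proof -
    have "length (filter (\<lambda>h. (h, v c) \<in> parcs H) (map v [1..<a])) =
        card (set (filter (\<lambda>h. (v h, v c) \<in> parcs H) [1..<a]))"
      by (subst distinct_card) (auto simp: filter_map o_def)
    also have "set (filter (\<lambda>h. (v h, v c) \<in> parcs H) [1..<a]) = {h \<in> {1..a - 1}. (v h, v c) \<in> parcs H}"
      by auto
    finally show ?thesis by (simp add: nbrs_upto_def)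
  qed
  show ?thesis
    unfolding split using notin ab by (subst pending_append) (auto simp only: count atLeastAtMost_iff order_refl less_imp_le)
qed

lemma char_fun_sym: "pair_graph G \<Longrightarrow> char_fun G x y = char_fun G y x"
  using pair_sym_digraph.pair_sym_arcs[of G]
  by (auto simp: char_fun_def pair_graph_def pair_pseudo_graph_def symmetric_def sym_def)

theorem theorem1p14:
  fixes m :: nat and H :: "nat pair_pre_digraph" and \<alpha> \<theta> :: real
  assumes "pair_graph H" and "pverts H = {1..m}"
    and "\<alpha> > 0" and "\<theta> > 0"
  shows "\<exists>c>0. \<exists>\<epsilon>>0.
    \<forall>(p::real) (\<Gamma>::'a pair_pre_digraph) (G::'a pair_pre_digraph)
     (X::nat \<Rightarrow> 'a set) (q::nat \<Rightarrow> nat \<Rightarrow> real).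
      0 < p \<and> p \<le> 1 \<and>
      pair_graph \<Gamma> \<and>
      (\<forall>i\<in>{1..m}. X i \<subseteq> pverts \<Gamma> \<and> X i \<noteq> {}) \<and>
      (\<forall>(i, j) \<in> up_edges H.
        jumbled (char_fun \<Gamma>) (X i) (X j) p
          (c * p powr (two_degeneracy H + 3) * sqrt (real (card (X i)) * real (card (X j))))) \<and>
      pair_graph G \<and> subgraph (with_proj G) (with_proj \<Gamma>) \<and>
      (\<forall>i\<in>{1..m}. X i \<subseteq> pverts G) \<and>
      (\<forall>(i, j) \<in> up_edges H.
        DISC (char_fun G) (X i) (X j) (q i j) p \<epsilon> \<and> \<alpha> * p \<le> q i j \<and> q i j \<le> p)
      \<longrightarrow> hom_density H X (char_fun G) \<ge> (1 - \<theta>) * edge_weight_prod H q"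
proof -
  interpret H: pair_graph H by (rule assms)
  define E where "E i j \<longleftrightarrow> (i, j) \<in> parcs H" for i j
  have E_sym: "E j i" if "E i j" for i j
    using that H.pair_sym_arcs by (auto simp: E_def symmetric_def sym_def)
  have E_irr: "\<not> E i i" for i
    using H.pair_no_loops by (force simp: E_def)
  have E_verts: "i \<in> {1..m}" "j \<in> {1..m}" if "E i j" for i j
    using H.in_arcsD1 H.in_arcsD2 that assms(2) by (auto simp: E_def)
  define d where "d = two_degeneracy H"
  have d: "two_degenerate H d"
    unfolding d_def using assms(2) by (intro two_degeneracy_minimum) simp
  then obtain v where v: "bij_betw v {1..m} {1..m}"
    and deg: "\<And>a b. a \<in> {1..m} \<Longrightarrow> b \<in> {1..m} \<Longrightarrow> a < b \<Longrightarrow> (v a, v b) \<in> parcs H \<Longrightarrow>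
      real (nbrs_upto H v (a - 1) a + nbrs_upto H v (a - 1) b) \<le> 2 * d"
    unfolding two_degenerate_def assms(2) by (auto simp: Ball_def)
  define vs where "vs = map v [1..<Suc m]"
  have upt: "set [1..<Suc m] = {1..m}"
    by (simp add: atLeastLessThanSuc_atLeastAtMost del: upt_Suc)
  have set_vs: "set vs = {1..m}"
    unfolding vs_def set_map upt using v by (rule bij_betw_imp_surj_on)
  have dist: "distinct vs"
    unfolding vs_def distinct_map upt using v by (simp add: bij_betw_imp_inj_on del: upt_Suc)
  have pending_le: "real (pending E vs j k) \<le> 2 * d" if jk: "E j k" for j k
  proof -
    obtain a b where ab: "a \<in> {1..m}" "b \<in> {1..m}" "j = v a" "k = v b"
      using E_verts[OF jk] v unfolding bij_betw_def by (metis imageE)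
    have E: "E = (\<lambda>i j. (i, j) \<in> parcs H)" by (intro ext) (simp add: E_def)
    from jk ab E_irr have "a \<noteq> b" by auto
    then consider "a < b" | "b < a" by linarith
    then show ?thesis
    proof cases
      case 1
      then show ?thesis
        using deg[OF ab(1,2) 1] pending_eq_nbrs_upto[OF v ab(1,2) 1, of H] jk ab
        by (simp add: vs_def E)
    next
      case 2
      then show ?thesis
        using deg[OF ab(2,1) 2] pending_eq_nbrs_upto[OF v ab(2,1) 2, of H] E_sym[OF jk] ab
          pending_commute[of E vs j k]
        by (simp add: vs_def E)
    qed
  qed
  \<comment> \<open>The counting argument takes \<alpha> and \<theta> at most 1; lowering either
    only weakens the hypothesis on \<open>q\<close> or strengthens the conclusion.\<close>
  define \<alpha>' where "\<alpha>' = min \<alpha> 1"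
  define \<theta>' where "\<theta>' = min \<theta> 1"
  have \<alpha>': "0 < \<alpha>'" "\<alpha>' \<le> 1" "\<alpha>' \<le> \<alpha>" and \<theta>': "0 < \<theta>'" "\<theta>' \<le> 1" "\<theta>' \<le> \<theta>"
    using assms by (auto simp: \<alpha>'_def \<theta>'_def)
  obtain c \<epsilon> where c: "0 < c" and \<epsilon>: "0 < \<epsilon>"
    and count: "\<And>p \<Gamma> (G :: 'a \<Rightarrow> 'a \<Rightarrow> real) q V. counting E \<Gamma> G q \<alpha>' p \<Longrightarrow>
      regular_system E \<Gamma> G q \<alpha>' p c \<epsilon> vs V \<Longrightarrow>
      (1 - \<theta>') * (edge_prod E q vs * (\<Prod>j\<in>set vs. real (card (V j)))) \<le> hom_count E G vs V"
    using counting_lemma[OF \<alpha>'(1) dist \<theta>'(1,2), of E] by blast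
  have "(1 - \<theta>) * edge_weight_prod H q \<le> hom_density H X (char_fun G)"
    if p: "0 < p" "p \<le> 1" and \<Gamma>: "pair_graph \<Gamma>"
      and X: "\<And>i. i \<in> {1..m} \<Longrightarrow> X i \<subseteq> pverts \<Gamma> \<and> X i \<noteq> {}"
      and jum: "\<And>i j. (i, j) \<in> up_edges H \<Longrightarrow> jumbled (char_fun \<Gamma>) (X i) (X j) p
          (c * p powr (two_degeneracy H + 3) * sqrt (real (card (X i)) * real (card (X j))))"
      and G: "pair_graph G" "subgraph (with_proj G) (with_proj \<Gamma>)"
      and disc: "\<And>i j. (i, j) \<in> up_edges H \<Longrightarrow> DISC (char_fun G) (X i) (X j) (q i j) p \<epsilon> \<and>
          \<alpha> * p \<le> q i j \<and> q i j \<le> p"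
    for p and \<Gamma> G :: "'a pair_pre_digraph" and X :: "nat \<Rightarrow> 'a set" and q :: "nat \<Rightarrow> nat \<Rightarrow> real"
  proof -
    \<comment> \<open>The hypotheses control \<open>q\<close> only for \<open>i < j\<close>, while
      the counting argument visits edges in both orientations.\<close>
    define q' where "q' i j = q (min i j) (max i j)" for i j
    have q'_sym: "q' i j = q' j i" for i j
      by (simp add: q'_def min.commute max.commute)
    have sub: "parcs G \<subseteq> parcs \<Gamma>"
      using G(2) by (auto simp: subgraph_def)
    have G01: "char_fun G x y \<in> {0, 1}" for x y
      by (simp add: char_fun_def)
    have cnt: "counting E (char_fun \<Gamma>) (char_fun G) q' \<alpha>' p"
      using E_sym char_fun_sym[OF G(1)] q'_sym \<alpha>' p sub
      by unfold_locales (auto simp: char_fun_def)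
    have finX: "finite (X i)" if "i \<in> {1..m}" for i
      using X[OF that] \<Gamma> finite_subset
      by (auto simp: pair_graph_def pair_digraph_def pair_fin_digraph_def pair_fin_digraph_axioms_def)
    have up: "jumbled (char_fun \<Gamma>) (X j) (X k) p
          (c * p powr (d + 3) * sqrt (real (card (X j)) * card (X k))) \<and>
        DISC (char_fun G) (X j) (X k) (q' j k) p \<epsilon> \<and> \<alpha>' * p \<le> q' j k \<and> q' j k \<le> p"
      if jk: "E j k" for j k
    proof -
      have *: ?thesis if "j < k"
      proof -
        have "(j, k) \<in> up_edges H" using jk that by (simp add: up_edges_def E_def)
        moreover have "q' j k = q j k" using that by (simp add: q'_def)
        moreover have "\<alpha>' * p \<le> \<alpha> * p" using \<alpha>' p by (intro mult_right_mono) auto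
        ultimately show ?thesis using jum[of j k] disc[of j k] by (auto simp: d_def)
      qed
      have **: ?thesis if "k < j"
      proof -
        have "(k, j) \<in> up_edges H" using E_sym[OF jk] that by (simp add: up_edges_def E_def)
        moreover have "q' j k = q k j" using that by (simp add: q'_def)
        moreover have "\<alpha>' * p \<le> \<alpha> * p" using \<alpha>' p by (intro mult_right_mono) auto
        moreover have "(\<lambda>y x. char_fun G x y) = char_fun G" "(\<lambda>y x. char_fun \<Gamma> x y) = char_fun \<Gamma>"
          using char_fun_sym[OF G(1)] char_fun_sym[OF \<Gamma>] by (auto intro!: ext)
        ultimately show ?thesis
          using jumbled_swap[OF jum[of k j]] DISC_swap[of "char_fun G" "X k" "X j" "q k j" p \<epsilon>] disc[of k j]
          by (auto simp: d_def mult.commute)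
      qed
      have "j \<noteq> k" using jk E_irr by auto
      with * ** show ?thesis by linarith
    qed
    have "regular_system E (char_fun \<Gamma>) (char_fun G) q' \<alpha>' p c \<epsilon> vs X"
      unfolding regular_system_def set_vs
    proof (intro conjI ballI impI)
      fix j k assume jk: "j \<in> {1..m}" "k \<in> {1..m}" "E j k"
      \<comment> \<open>Here the exponent \<open>d + 3\<close> is split: \<open>p ^ 3\<close> is
        kept for the inheritance of regularity, and \<open>p powr d\<close> pays for the pending
        shrinkage, at most \<open>2 * d\<close> steps under a square root.\<close>
      have "p powr d \<le> sqrt (p ^ pending E vs j k)"
      proof -
        have "p powr d \<le> p powr (real (pending E vs j k) / 2)"
          using pending_le[OF jk(3)] p by (intro powr_mono') auto
        also have "\<dots> = sqrt (p ^ pending E vs j k)"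
          using p by (simp add: powr_half_sqrt[symmetric] powr_realpow[symmetric] powr_powr)
        finally show ?thesis .
      qed
      then have "c * p ^ 3 * (p powr d * sqrt (real (card (X j)) * card (X k))) \<le>
          c * p ^ 3 * (sqrt (p ^ pending E vs j k) * sqrt (real (card (X j)) * card (X k)))"
        using c p by (intro mult_left_mono mult_right_mono) auto
      moreover have "p powr (d + 3) = p ^ 3 * p powr d"
        using p by (simp add: powr_add powr_numeral)
      ultimately have "c * p powr (d + 3) * sqrt (real (card (X j)) * card (X k)) \<le>
          c * p ^ 3 * sqrt (p ^ pending E vs j k * (real (card (X j)) * card (X k)))"
        by (simp add: real_sqrt_mult mult_ac)
      then show "jumbled (char_fun \<Gamma>) (X j) (X k) p
          (c * p ^ 3 * sqrt (p ^ pending E vs j k * (real (card (X j)) * card (X k))))"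
        using up[OF jk(3)] finX jk by (intro jumbled_mono[OF conjunct1[OF up[OF jk(3)]]]) auto
    qed (use up X finX in auto)
    note main = count[OF cnt this]
    have w: "edge_prod E w vs = (\<Prod>(i, j)\<in>up_edges H. w i j)" if "\<And>i j. w i j = w j i" for w :: "nat \<Rightarrow> nat \<Rightarrow> real"
    proof -
      have "{(i, j). E i j \<and> i < j \<and> i \<in> set vs \<and> j \<in> set vs} = up_edges H"
        using E_verts by (auto simp: up_edges_def E_def set_vs)
      then show ?thesis
        using edge_prod_eq_prod_pairs[of E w vs, OF E_sym E_irr that dist] by simp
    qed
    have ep: "edge_prod E q' vs = edge_weight_prod H q"
      unfolding w[of q', OF q'_sym] edge_weight_prod_def
      by (intro prod.cong) (auto simp: up_edges_def q'_def)
    have hc: "hom_count E (char_fun G) vs X = (\<Sum>x\<in>Pi\<^sub>E {1..m} X. \<Prod>(i, j)\<in>up_edges H. char_fun G (x i) (x j))"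
      using finX dist char_fun_sym[OF G(1)]
      by (subst hom_count_eq_sum[OF G01]) (auto simp: set_vs intro!: sum.cong w)
    have pos: "0 < (\<Prod>i\<in>{1..m}. real (card (X i)))"
      using X finX by (intro prod_pos) (auto simp: card_gt_0_iff)
    have "hom_density H X (char_fun G) = hom_count E (char_fun G) vs X / (\<Prod>i\<in>{1..m}. real (card (X i)))"
      by (simp add: hom_density_def assms(2) hc)
    with main pos have le: "(1 - \<theta>') * edge_weight_prod H q \<le> hom_density H X (char_fun G)"
      by (simp only: ep set_vs pos_le_divide_eq mult.assoc)
    \<comment> \<open>Nonnegativity allows the return from \<open>\<theta>'\<close> to
      \<theta>.\<close>
    have "0 \<le> q i j" if "(i, j) \<in> up_edges H" for i j
    proof -
      have "0 \<le> \<alpha> * p" using assms(3) p by simp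
      then show ?thesis using disc[OF that] by linarith
    qed
    then have "0 \<le> edge_weight_prod H q"
      unfolding edge_weight_prod_def by (intro prod_nonneg) auto
    then have "(1 - \<theta>) * edge_weight_prod H q \<le> (1 - \<theta>') * edge_weight_prod H q"
      using \<theta>' by (intro mult_right_mono) auto
    with le show ?thesis by linarith
  qed
  then show ?thesis
    using c \<epsilon> by (intro exI[of _ c] exI[of _ \<epsilon>] conjI) (auto simp: Ball_def)
qed

end
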